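(* In the transductive online matrix completion problem with trace-norm bound $B$ and convex $\rho$-Lipschitz loss, consider the randomized strategy that at round $t$ draws random $\{\pm1\}$-valued (Rademacher) $\epsilon_{t+1},\dots,\epsilon_T$ and predicts $$\hat y_t(\epsilon)=\inf_{\|f\|_\Sigma\le B}\Big\{-\sum_{i=t+1}^T\epsilon_i\langle f,x_i\rangle+\frac1{2\rho}\sum_{i=1}^{t-1}\ell(\langle f,x_i\rangle,y_i)+\frac12\langle f,x_t\rangle\Big\}-\inf_{\|f\|_\Sigma\le B}\Big\{-\sum_{i=t+1}^T\epsilon_i\langle f,x_i\rangle+\frac1{2\rho}\sum_{i=1}^{t-1}\ell(\langle f,x_i\rangle,y_i)-\frac12\langle f,x_t\rangle\Big\}.$$ Its expected regret is bounded as $$\mathbb E[\mathbf{Reg}_T]\le2B\rho\,\mathbb E_\epsilon\Big[\Big\|\sum_{t=1}^T\epsilon_tx_t\Big\|_\sigma\Big]\le O\big(B\rho(\sqrt m+\sqrt n)\big).$$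
   Context: Setting: a sequence of entry locations of an $m\times n$ matrix is known in advance, and only the entry values are unknown; $x_t\in\mathbb R^{m\times n}$ is the matrix with a $1$ at the $t$-th location and $0$ elsewhere ($t=1,\dots,T$). On round $t$ the learner makes a prediction $\hat y_t$ for the entry at location $x_t$, the adversary chooses its value $y_t$, and the learner suffers $\ell(\hat y_t,y_t)$, where $\ell$ is convex and $\rho$-Lipschitz in the prediction. $\langle f,x\rangle=\mathrm{tr}(f^{\top}x)$, $\|\cdot\|_\Sigma$ is the trace (nuclear) norm, $\|\cdot\|_\sigma$ the spectral norm. $\mathbf{Reg}_T=\sum_{t=1}^T\ell(\hat y_t,y_t)-\inf_{f\in\mathbb R^{m\times n}:\|f\|_\Sigma\le B}\sum_{t=1}^T\ell(\langle f,x_t\rangle,y_t)$. The $\epsilon$'s are i.i.d. Rademacher variables.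
   Formalization: The second inequality (the O(Bρ(√m+√n)) bound) is stated only for pairwise distinct entry locations: for m=n=1 with the entry repeated T times the expected spectral norm grows like √T. The first inequality holds for arbitrary location sequences. *)

theory Defs
  imports
    "HOL-Analysis.Analysis"
    "HOL-Probability.Product_PMF"
    "Jordan_Normal_Form.Char_Poly"
begin

text \<open>
  Matrices are those of \<^theory>\<open>Jordan_Normal_Form.Matrix\<close>, whose dimensions are numbers rather
  than types, so that one constant can be asserted for all dimensions. Row, column and round
  indices start at 0: rounds are \<open>0, \<dots>, T - 1\<close>.
\<close>

definition mat_trace :: "real mat \<Rightarrow> real" where
  "mat_trace A = (\<Sum>i<dim_row A. A $$ (i, i))"

definition mat_inner :: "real mat \<Rightarrow> real mat \<Rightarrow> real" where
  "mat_inner f x = mat_trace (transpose_mat f * x)"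

text \<open>
  The sum of the singular values, i.e. of the square roots of the eigenvalues of \<open>A\<^sup>T A\<close>, each
  counted with its algebraic multiplicity.
\<close>

definition trace_norm :: "real mat \<Rightarrow> real" where
  "trace_norm A =
     (let G = transpose_mat A * A
      in \<Sum>k | eigenvalue G k. real (order k (char_poly G)) * sqrt k)"

definition euclid_norm :: "real Matrix.vec \<Rightarrow> real" where
  "euclid_norm v = sqrt (scalar_prod v v)"

text \<open>
  The bound \<open>\<le> 1\<close> (rather than \<open>= 1\<close>) keeps the supremum over a nonempty set when there are no
  columns.
\<close>

definition spectral_norm :: "real mat \<Rightarrow> real" where
  "spectral_norm A =
     (SUP v\<in>{v \<in> carrier_vec (dim_col A). euclid_norm v \<le> 1}. euclid_norm (A *\<^sub>v v))"

definition trace_ball :: "nat \<Rightarrow> nat \<Rightarrow> real \<Rightarrow> real mat set" where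
  "trace_ball m n B = {f \<in> carrier_mat m n. trace_norm f \<le> B}"

definition entry_mat :: "nat \<Rightarrow> nat \<Rightarrow> nat \<times> nat \<Rightarrow> real mat" where
  "entry_mat m n p = mat m n (\<lambda>q. if q = p then 1 else 0)"

definition signed_sum :: "nat \<Rightarrow> nat \<Rightarrow> nat \<Rightarrow> (nat \<Rightarrow> real mat) \<Rightarrow> (nat \<Rightarrow> real) \<Rightarrow> real mat" where
  "signed_sum m n T x \<epsilon> = mat m n (\<lambda>q. \<Sum>t<T. \<epsilon> t * x t $$ q)"

definition rademacher :: "nat set \<Rightarrow> (nat \<Rightarrow> real) pmf" where
  "rademacher I = Pi_pmf I 0 (\<lambda>_. pmf_of_set {-1, 1})"

text \<open>
  The prediction in round \<open>t\<close> against the comparator set \<open>F\<close>; only \<open>y i\<close> for \<open>i < t\<close> and \<open>\<epsilon> i\<close>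
  for \<open>t < i < T\<close> matter.
\<close>

definition prediction ::
    "real mat set \<Rightarrow> real \<Rightarrow> (real \<Rightarrow> real \<Rightarrow> real) \<Rightarrow> nat \<Rightarrow> (nat \<Rightarrow> real mat) \<Rightarrow> nat
      \<Rightarrow> (nat \<Rightarrow> real) \<Rightarrow> (nat \<Rightarrow> real) \<Rightarrow> real" where
  "prediction F \<rho> loss T x t y \<epsilon> =
     (INF f\<in>F. - (\<Sum>i\<in>{t<..<T}. \<epsilon> i * mat_inner f (x i))
        + 1 / (2 * \<rho>) * (\<Sum>i<t. loss (mat_inner f (x i)) (y i)) + 1 / 2 * mat_inner f (x t))
   - (INF f\<in>F. - (\<Sum>i\<in>{t<..<T}. \<epsilon> i * mat_inner f (x i))
        + 1 / (2 * \<rho>) * (\<Sum>i<t. loss (mat_inner f (x i)) (y i)) - 1 / 2 * mat_inner f (x t))"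

text \<open>
  The list of pairs (prediction, outcome) of the first \<open>t\<close> rounds, where \<open>E s\<close> are the signs drawn
  in round \<open>s\<close>. The adversary is adaptive: the outcome of a round is a function of all earlier
  pairs, but not of the current draw.
\<close>

fun play ::
    "real mat set \<Rightarrow> real \<Rightarrow> (real \<Rightarrow> real \<Rightarrow> real) \<Rightarrow> nat \<Rightarrow> (nat \<Rightarrow> real mat)
      \<Rightarrow> ((real \<times> real) list \<Rightarrow> real) \<Rightarrow> (nat \<Rightarrow> nat \<Rightarrow> real) \<Rightarrow> nat \<Rightarrow> (real \<times> real) list" where
  "play F \<rho> loss T x adv E 0 = []"
| "play F \<rho> loss T x adv E (Suc t) =
     (let h = play F \<rho> loss T x adv E t
      in h @ [(prediction F \<rho> loss T x t (\<lambda>i. snd (h ! i)) (E t), adv h)])"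

definition regret ::
    "real mat set \<Rightarrow> (real \<Rightarrow> real \<Rightarrow> real) \<Rightarrow> nat \<Rightarrow> (nat \<Rightarrow> real mat) \<Rightarrow> (real \<times> real) list
      \<Rightarrow> real" where
  "regret F loss T x h =
     (\<Sum>t<T. loss (fst (h ! t)) (snd (h ! t)))
     - (INF f\<in>F. \<Sum>t<T. loss (mat_inner f (x t)) (snd (h ! t)))"

text \<open>Fresh signs are drawn in every round, independently of those of the other rounds.\<close>

definition draws :: "nat \<Rightarrow> (nat \<Rightarrow> nat \<Rightarrow> real) pmf" where
  "draws T = Pi_pmf {..<T} (\<lambda>_. 0) (\<lambda>t. rademacher {t<..<T})"

definition expected_regret ::
    "real mat set \<Rightarrow> real \<Rightarrow> (real \<Rightarrow> real \<Rightarrow> real) \<Rightarrow> nat \<Rightarrow> (nat \<Rightarrow> real mat)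
      \<Rightarrow> ((real \<times> real) list \<Rightarrow> real) \<Rightarrow> real" where
  "expected_regret F \<rho> loss T x adv =
     measure_pmf.expectation (draws T) (\<lambda>E. regret F loss T x (play F \<rho> loss T x adv E T))"

end

theory Submission
  imports Defs
begin

text \<open>
  Write \<open>W t y \<epsilon>\<close> for the supremum over the comparators \<open>f\<close> of
  \<open>\<Sum>i\<ge>t. \<epsilon> i * \<langle>f, x i\<rangle> - 1 / (2 * \<rho>) * \<Sum>i<t. loss \<langle>f, x i\<rangle> (y i)\<close>. The prediction in
  round \<open>t\<close> is the difference of the values of \<open>W\<close> at \<open>\<epsilon> t = 1/2\<close> and \<open>\<epsilon> t = -1/2\<close>, which
  balances the two linear bounds on the \<open>\<rho>\<close>-Lipschitz loss difference. Hence the loss so far plus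
  \<open>2 * \<rho> * E (W t y)\<close> is a supermartingale; it starts at the Rademacher complexity of the
  comparators and ends above the regret. Duality of trace norm and spectral norm bounds the former
  by the expected spectral norm of the random sign matrix, which is of order \<open>\<surd>(m + n)\<close> by a union
  bound over \<open>1/2\<close>-nets of the two unit balls.
\<close>

text \<open>The halves come from the scaling: the loss difference is at most
  \<open>\<rho> * \<bar>p - g\<bar>\<close> for the prediction \<open>p\<close> and a comparator
  value \<open>g\<close>, and after division by \<open>2 * \<rho>\<close> its two linear branches
  have slopes 1/2 and -1/2 in \<open>g\<close>. As a supremum of functions affine in the coefficient
  of round \<open>t\<close>, \<open>W\<close> is convex in it, so its values at the halves sum to at
  most its values at 1 and -1, which a random sign averages. The step inequality holds for every
  fixed choice of the later signs. The draw behind the prediction has the same distribution as the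
  signs still averaged in \<open>W\<close>, and the outcome of the round does not depend on it;
  hence one draw can play both roles even against an adaptive adversary. On the matrix side, the
  trace norm is given by multiplicities of characteristic roots and the spectral norm by a supremum.
  Their duality passes through an orthogonal diagonalization of \<open>f\<^sup>T f\<close>; no
  singular value decomposition of \<open>f\<close> is formed.\<close>

unbundle no vec_syntax
unbundle no inner_syntax

section \<open>Euclidean and spectral norm\<close>

lemma euclid_norm_L2: "euclid_norm v = L2_set (\<lambda>i. v $ i) {..<dim_vec v}"
  by (simp add: euclid_norm_def scalar_prod_def L2_set_def power2_eq_square atLeast0LessThan)

lemma euclid_norm_nonneg [simp]: "0 \<le> euclid_norm v"
  by (simp add: euclid_norm_L2)

lemma euclid_norm_sq: "(euclid_norm v)\<^sup>2 = v \<bullet> v"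
  by (simp add: euclid_norm_L2 L2_set_def sum_nonneg scalar_prod_def power2_eq_square atLeast0LessThan)

lemma euclid_norm_zero [simp]: "euclid_norm (0\<^sub>v n) = 0"
  by (simp add: euclid_norm_def)

lemma scalar_prod_le_euclid_norm:
  assumes "dim_vec v = dim_vec w"
  shows "v \<bullet> w \<le> euclid_norm v * euclid_norm w"
proof -
  have "v \<bullet> w \<le> (\<Sum>i<dim_vec w. \<bar>v $ i\<bar> * \<bar>w $ i\<bar>)"
    unfolding scalar_prod_def atLeast0LessThan by (intro sum_mono) (metis abs_ge_self abs_mult)
  also have "\<dots> \<le> euclid_norm v * euclid_norm w"
    unfolding euclid_norm_L2 assms by (rule L2_set_mult_ineq)
  finally show ?thesis .
qed

lemma euclid_norm_triangle:
  assumes "v \<in> carrier_vec n" "w \<in> carrier_vec n"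
  shows "euclid_norm (v + w) \<le> euclid_norm v + euclid_norm w"
proof -
  have "euclid_norm (v + w) = L2_set (\<lambda>i. v $ i + w $ i) {..<n}"
    unfolding euclid_norm_L2 using assms by (intro L2_set_cong) auto
  also have "\<dots> \<le> euclid_norm v + euclid_norm w"
    using assms L2_set_triangle_ineq by (simp add: euclid_norm_L2)
  finally show ?thesis .
qed

lemma euclid_norm_smult: "euclid_norm (c \<cdot>\<^sub>v v) = \<bar>c\<bar> * euclid_norm v"
proof -
  have "(euclid_norm (c \<cdot>\<^sub>v v))\<^sup>2 = (\<bar>c\<bar> * euclid_norm v)\<^sup>2"
    unfolding power_mult_distrib euclid_norm_sq power2_abs by (simp add: power2_eq_square)
  thus ?thesis
    by (subst (asm) power2_eq_iff_nonneg) auto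
qed

lemma euclid_norm_eq_0_iff:
  assumes "v \<in> carrier_vec n"
  shows "euclid_norm v = 0 \<longleftrightarrow> v = 0\<^sub>v n"
  using assms by (auto simp: euclid_norm_L2 L2_set_eq_0_iff)

text \<open>A supremum of reals is informative only with an upper bound at hand. Each coordinate of
  the image is a scalar product with a row, so Cauchy-Schwarz bounds it by the norm of that
  row.\<close>

lemma spectral_norm_bdd:
  "bdd_above ((\<lambda>v. euclid_norm (A *\<^sub>v v)) ` {v \<in> carrier_vec (dim_col A). euclid_norm v \<le> 1})"
proof (rule bdd_aboveI2)
  fix v assume v: "v \<in> {v \<in> carrier_vec (dim_col A). euclid_norm v \<le> 1}"
  have "euclid_norm (A *\<^sub>v v) \<le> (\<Sum>i<dim_row A. \<bar>(A *\<^sub>v v) $ i\<bar>)"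
    using L2_set_le_sum_abs[of "\<lambda>i. (A *\<^sub>v v) $ i" "{..<dim_row A}"] by (simp add: euclid_norm_L2)
  also have "\<dots> \<le> (\<Sum>i<dim_row A. euclid_norm (row A i))"
  proof (rule sum_mono)
    fix i assume i: "i \<in> {..<dim_row A}"
    have 1: "row A i \<bullet> v \<le> euclid_norm (row A i) * euclid_norm v"
      using v by (intro scalar_prod_le_euclid_norm) auto
    \<comment> \<open>Passing to the negated vector turns the one-sided Cauchy-Schwarz bound into
      one on the absolute value.\<close>
    have 2: "row A i \<bullet> ((-1) \<cdot>\<^sub>v v) \<le> euclid_norm (row A i) * euclid_norm ((-1) \<cdot>\<^sub>v v)"
      using v by (intro scalar_prod_le_euclid_norm) auto
    have 3: "row A i \<bullet> ((-1) \<cdot>\<^sub>v v) = - (row A i \<bullet> v)"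
      using v by (subst scalar_prod_smult_distrib) auto
    have "euclid_norm (row A i) * euclid_norm v \<le> euclid_norm (row A i) * 1"
      using v by (intro mult_left_mono) auto
    with 1 2 3 show "\<bar>(A *\<^sub>v v) $ i\<bar> \<le> euclid_norm (row A i)"
      using i by (simp add: euclid_norm_smult)
  qed
  finally show "euclid_norm (A *\<^sub>v v) \<le> (\<Sum>i<dim_row A. euclid_norm (row A i))" .
qed

lemma euclid_norm_le_spectral_norm:
  assumes "v \<in> carrier_vec (dim_col A)" "euclid_norm v \<le> 1"
  shows "euclid_norm (A *\<^sub>v v) \<le> spectral_norm A"
  unfolding spectral_norm_def using assms by (intro cSUP_upper spectral_norm_bdd) auto

lemma spectral_norm_nonneg: "0 \<le> spectral_norm A"
  by (rule order_trans[OF euclid_norm_nonneg euclid_norm_le_spectral_norm[of "0\<^sub>v (dim_col A)"]]) auto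

lemma spectral_norm_leI:
  assumes "\<And>v. v \<in> carrier_vec (dim_col A) \<Longrightarrow> euclid_norm v \<le> 1 \<Longrightarrow> euclid_norm (A *\<^sub>v v) \<le> c"
  shows "spectral_norm A \<le> c"
proof -
  have "0\<^sub>v (dim_col A) \<in> {v \<in> carrier_vec (dim_col A). euclid_norm v \<le> 1}" by simp
  thus ?thesis
    unfolding spectral_norm_def using assms by (intro cSUP_least) blast+
qed

lemma euclid_norm_mult_mat_vec_le:
  assumes v: "v \<in> carrier_vec (dim_col A)"
  shows "euclid_norm (A *\<^sub>v v) \<le> spectral_norm A * euclid_norm v"
proof (cases "euclid_norm v = 0")
  case True
  with v have "v = 0\<^sub>v (dim_col A)" using euclid_norm_eq_0_iff by blast
  hence "A *\<^sub>v v = 0\<^sub>v (dim_row A)" by auto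
  with True show ?thesis by simp
next
  case False
  let ?u = "inverse (euclid_norm v) \<cdot>\<^sub>v v"
  have "euclid_norm (A *\<^sub>v ?u) \<le> spectral_norm A"
    using v False by (intro euclid_norm_le_spectral_norm) (auto simp: euclid_norm_smult)
  also have "A *\<^sub>v ?u = inverse (euclid_norm v) \<cdot>\<^sub>v (A *\<^sub>v v)"
    using v by (intro mult_mat_vec) auto
  finally show ?thesis
    using False euclid_norm_nonneg[of v] by (simp add: euclid_norm_smult field_simps)
qed

section \<open>The trace inner product in columns and entries\<close>

lemma mat_inner_sum:
  assumes "f \<in> carrier_mat m n" "g \<in> carrier_mat m n"
  shows "mat_inner f g = (\<Sum>j<n. col f j \<bullet> col g j)"
  using assms by (auto simp: mat_inner_def mat_trace_def intro!: sum.cong)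

lemma mat_inner_sum_entries:
  assumes "f \<in> carrier_mat m n" "g \<in> carrier_mat m n"
  shows "mat_inner f g = (\<Sum>j<n. \<Sum>i<m. f $$ (i, j) * g $$ (i, j))"
  unfolding mat_inner_sum[OF assms] using assms
  by (auto simp: scalar_prod_def atLeast0LessThan intro!: sum.cong)

text \<open>Cyclicity of the trace,
  \<open>tr (P\<^sup>T f\<^sup>T g P) = tr (f\<^sup>T g P P\<^sup>T)\<close>, carried out in
  entries. It lets the duality be checked in a basis adapted to \<open>f\<close>.\<close>

lemma mat_inner_mult_orthogonal:
  assumes f: "f \<in> carrier_mat m n" and g: "g \<in> carrier_mat m n"
    and P: "P \<in> carrier_mat n n" "P * transpose_mat P = 1\<^sub>m n"
  shows "mat_inner (f * P) (g * P) = mat_inner f g"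
proof -
  have PP: "(\<Sum>j<n. P $$ (k, j) * P $$ (l, j)) = (if k = l then 1 else 0)" if "k < n" "l < n" for k l
  proof -
    have "(P * transpose_mat P) $$ (k, l) = (\<Sum>j<n. P $$ (k, j) * P $$ (l, j))"
      using that P(1) by (auto simp: scalar_prod_def atLeast0LessThan intro!: sum.cong)
    with that P(2) show ?thesis by simp
  qed
  have mul: "(h * P) $$ (i, j) = (\<Sum>k<n. h $$ (i, k) * P $$ (k, j))"
    if "h \<in> carrier_mat m n" "i < m" "j < n" for h i j
    using that P(1) by (auto simp: scalar_prod_def atLeast0LessThan intro!: sum.cong)
  have "mat_inner (f * P) (g * P)
      = (\<Sum>j<n. \<Sum>i<m. \<Sum>k<n. \<Sum>l<n. f $$ (i, k) * g $$ (i, l) * (P $$ (k, j) * P $$ (l, j)))"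
    unfolding mat_inner_sum_entries[OF mult_carrier_mat[OF f P(1)] mult_carrier_mat[OF g P(1)]]
    by (intro sum.cong refl) (simp add: mul f g sum_product algebra_simps)
  \<comment> \<open>The exchanges move the sum over \<open>j\<close> innermost, where orthonormality
    of the rows of \<open>P\<close> collapses it.\<close>
  also have "\<dots> = (\<Sum>i<m. \<Sum>j<n. \<Sum>k<n. \<Sum>l<n. f $$ (i, k) * g $$ (i, l) * (P $$ (k, j) * P $$ (l, j)))"
    by (rule sum.swap)
  also have "\<dots> = (\<Sum>i<m. \<Sum>k<n. \<Sum>j<n. \<Sum>l<n. f $$ (i, k) * g $$ (i, l) * (P $$ (k, j) * P $$ (l, j)))"
    by (rule sum.cong[OF refl], rule sum.swap)
  also have "\<dots> = (\<Sum>i<m. \<Sum>k<n. \<Sum>l<n. \<Sum>j<n. f $$ (i, k) * g $$ (i, l) * (P $$ (k, j) * P $$ (l, j)))"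
    by (rule sum.cong[OF refl], rule sum.cong[OF refl], rule sum.swap)
  also have "\<dots> = (\<Sum>i<m. \<Sum>k<n. \<Sum>l<n. f $$ (i, k) * g $$ (i, l) * (if k = l then 1 else 0))"
    by (intro sum.cong refl) (simp add: PP flip: sum_distrib_left)
  also have "\<dots> = (\<Sum>i<m. \<Sum>k<n. f $$ (i, k) * g $$ (i, k))"
    by (intro sum.cong refl) (simp add: if_distrib[where f = "\<lambda>x. _ * x"] cong: if_cong)
  also have "\<dots> = mat_inner f g"
    unfolding mat_inner_sum_entries[OF f g] by (rule sum.swap)
  finally show ?thesis .
qed

section \<open>Orthogonal diagonalization and trace norm duality\<close>

text \<open>The characteristic polynomial has a complex root \<open>z\<close> with an eigenvector
  \<open>v\<close>. Since \<open>A\<close> is real and symmetric, the Hermitian form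
  \<open>q\<close> of \<open>A\<close> at \<open>v\<close> equals its own conjugate; it is also
  \<open>z\<close> times the positive real \<open>s\<close>, so \<open>z\<close> is real.\<close>

lemma symmetric_eigenvalue_exists:
  fixes A :: "real mat"
  assumes A: "A \<in> carrier_mat n n" and sym: "transpose_mat A = A" and n: "n > 0"
  obtains k where "eigenvalue A k"
proof -
  let ?C = "map_mat complex_of_real A"
  have C: "?C \<in> carrier_mat n n" using A by simp
  have "degree (char_poly ?C) \<noteq> 0"
    using degree_monic_char_poly[OF C] n by simp
  hence "\<not> constant (poly (char_poly ?C))"
    by (simp add: constant_degree)
  then obtain z where z: "poly (char_poly ?C) z = 0"
    using fundamental_theorem_of_algebra by blast
  then obtain v where v: "v \<in> carrier_vec n" "v \<noteq> 0\<^sub>v n" "?C *\<^sub>v v = z \<cdot>\<^sub>v v"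
    using eigenvalue_root_char_poly[OF C] A unfolding eigenvalue_def eigenvector_def by auto
  have row: "(\<Sum>j<n. complex_of_real (A $$ (i, j)) * v $ j) = z * v $ i" if "i < n" for i
  proof -
    have "(?C *\<^sub>v v) $ i = (\<Sum>j<n. complex_of_real (A $$ (i, j)) * v $ j)"
      using that A v(1) by (auto simp: scalar_prod_def atLeast0LessThan intro!: sum.cong)
    with v that show ?thesis by simp
  qed
  define s where "s = (\<Sum>i<n. (cmod (v $ i))\<^sup>2)"
  define q where "q = (\<Sum>i<n. \<Sum>j<n. cnj (v $ i) * complex_of_real (A $$ (i, j)) * v $ j)"
  have q: "q = z * of_real s"
  proof -
    have "q = (\<Sum>i<n. cnj (v $ i) * (z * v $ i))"
      unfolding q_def by (intro sum.cong refl) (simp add: mult.assoc flip: sum_distrib_left row)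
    also have "\<dots> = z * of_real s"
      unfolding s_def of_real_sum sum_distrib_left
      by (intro sum.cong refl, subst complex_norm_square) (simp add: mult_ac)
    finally show ?thesis .
  qed
  have Asym: "A $$ (j, i) = A $$ (i, j)" if "i < n" "j < n" for i j
    using that A arg_cong[OF sym, of "\<lambda>B. B $$ (i, j)"] by simp
  have "cnj q = (\<Sum>i<n. \<Sum>j<n. cnj (v $ j) * complex_of_real (A $$ (i, j)) * v $ i)"
    unfolding q_def by (simp add: mult_ac)
  also have "\<dots> = q"
    unfolding q_def by (subst sum.swap) (intro sum.cong refl, simp add: Asym)
  finally have "cnj q = q" .
  moreover have "s \<noteq> 0"
  proof
    assume "s = 0"
    hence "\<forall>i<n. v $ i = 0"
      unfolding s_def by (subst (asm) sum_nonneg_eq_0_iff) auto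
    hence "v = 0\<^sub>v n" using v(1) by auto
    with v(2) show False by simp
  qed
  ultimately have "cnj z = z" unfolding q by simp
  then obtain k where k: "z = of_real k"
    by (metis Reals_cnj_iff Reals_cases)
  have "complex_of_real (poly (char_poly A) k) = 0"
    using z unfolding k of_real_hom.char_poly_hom[OF A] by simp
  hence "eigenvalue A k"
    using eigenvalue_root_char_poly[OF A] by simp
  thus ?thesis by (rule that)
qed

text \<open>The Householder reflection that exchanges \<open>v\<close> and the first unit vector.\<close>

lemma orthogonal_with_first_col:
  assumes v: "v \<in> carrier_vec n" "euclid_norm v = 1" and n: "n > 0"
  obtains W where "W \<in> carrier_mat n n" "transpose_mat W * W = 1\<^sub>m n" "col W 0 = v"
proof -
  define w where "w i = v $ i - (if i = 0 then 1 else 0)" for i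
  define s where "s = (\<Sum>i<n. w i * w i)"
  \<comment> \<open>If \<open>v\<close> is already the first unit vector, then \<open>s = 0\<close>,
    the quotient \<open>2 / s\<close> is 0 by convention, and \<open>W\<close> is the
    identity.\<close>
  define W where "W = mat n n (\<lambda>(i, j). (if i = j then 1 else 0) - 2 / s * w i * w j)"
  have W: "W \<in> carrier_mat n n" unfolding W_def by simp
  have vv: "(\<Sum>i<n. v $ i * v $ i) = 1"
    using euclid_norm_sq[of v] v by (simp add: scalar_prod_def atLeast0LessThan)
  have "s = (\<Sum>i<n. v $ i * v $ i - 2 * (if i = 0 then v $ i else 0) + (if i = 0 then 1 else 0))"
    unfolding s_def w_def by (intro sum.cong refl) (auto simp: algebra_simps)
  also have "\<dots> = 2 - 2 * v $ 0"
    using n by (simp add: sum.distrib sum_subtractf vv flip: sum_distrib_left)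
  \<comment> \<open>This relation makes column 0 of the reflection the first unit vector plus
    \<open>w\<close>, which is \<open>v\<close>.\<close>
  finally have s: "s = - 2 * w 0" by (simp add: w_def)
  have w0: "w i = 0" if "s = 0" "i < n" for i
    using that unfolding s_def by (subst (asm) sum_nonneg_eq_0_iff) auto
  have sum_delta: "(\<Sum>k<n. (if k = i then 1 else 0) * h k) = h i" if "i < n" for i and h :: "nat \<Rightarrow> real"
    using that by (simp add: if_distrib[where f = "\<lambda>x. x * _"] cong: if_cong)
  have "(transpose_mat W * W) $$ (i, j) = (1\<^sub>m n) $$ (i, j)" if ij: "i < n" "j < n" for i j
  proof -
    let ?d = "\<lambda>k l. if k = l then 1 else (0::real)"
    have "(transpose_mat W * W) $$ (i, j)
        = (\<Sum>k<n. (?d k i - 2 / s * w k * w i) * (?d k j - 2 / s * w k * w j))"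
      using ij by (auto simp: W_def scalar_prod_def atLeast0LessThan intro!: sum.cong)
    also have "\<dots> = (\<Sum>k<n. ?d k i * ?d k j) - (\<Sum>k<n. ?d k i * (2 / s * w k * w j))
        - (\<Sum>k<n. ?d k j * (2 / s * w k * w i)) + 2 / s * w i * (2 / s * w j) * (\<Sum>k<n. w k * w k)"
      unfolding sum_distrib_left sum_subtractf[symmetric] sum.distrib[symmetric]
      by (intro sum.cong refl) (simp only: algebra_simps)
    also have "\<dots> = ?d i j - 2 * (2 / s * w i * w j) + 2 / s * w i * (2 / s * w j) * s"
      unfolding sum_delta[OF ij(1)] sum_delta[OF ij(2)] s_def[symmetric] by simp
    also have "\<dots> = ?d i j"
      using w0 ij by (cases "s = 0") (auto simp: field_simps)
    finally show ?thesis using ij by simp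
  qed
  hence WW: "transpose_mat W * W = 1\<^sub>m n"
    using W by (intro eq_matI) auto
  have "W $$ (i, 0) = v $ i" if "i < n" for i
  proof (cases "s = 0")
    case True
    with that n w0[OF True that] show ?thesis by (auto simp: W_def w_def)
  next
    case False
    have "2 / s * w i * w 0 = - w i" using False by (simp add: s field_simps)
    thus ?thesis using that n by (simp add: W_def w_def)
  qed
  hence "col W 0 = v" using W v n by (intro eq_vecI) auto
  with W WW show ?thesis by (rule that)
qed

text \<open>Deflation: in an orthonormal basis that starts with a unit eigenvector, the first column
  vanishes below the diagonal, symmetry clears the first row, and the remaining block is symmetric
  of dimension one less.\<close>

lemma symmetric_orthogonally_diagonalizable:
  fixes A :: "real mat"
  assumes "A \<in> carrier_mat n n" "transpose_mat A = A"
  shows "\<exists>P\<in>carrier_mat n n. transpose_mat P * P = 1\<^sub>m n \<and> diagonal_mat (transpose_mat P * A * P)"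
  using assms
proof (induction n arbitrary: A)
  case 0
  thus ?case by (intro bexI[of _ "1\<^sub>m 0"]) (auto simp: diagonal_mat_def)
next
  case (Suc n)
  note A = Suc.prems(1) and sym = Suc.prems(2)
  obtain k where "eigenvalue A k"
    using symmetric_eigenvalue_exists[OF A sym] by auto
  then obtain v where v: "v \<in> carrier_vec (Suc n)" "v \<noteq> 0\<^sub>v (Suc n)" "A *\<^sub>v v = k \<cdot>\<^sub>v v"
    using A unfolding eigenvalue_def eigenvector_def by auto
  define u where "u = inverse (euclid_norm v) \<cdot>\<^sub>v v"
  have nv: "euclid_norm v \<noteq> 0" using v euclid_norm_eq_0_iff by blast
  have u: "u \<in> carrier_vec (Suc n)" "euclid_norm u = 1"
    using v nv by (auto simp: u_def euclid_norm_smult)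
  have Au: "A *\<^sub>v u = k \<cdot>\<^sub>v u"
    unfolding u_def mult_mat_vec[OF A v(1)] v(3) by (simp add: smult_smult_assoc mult.commute)
  obtain W where W: "W \<in> carrier_mat (Suc n) (Suc n)" "transpose_mat W * W = 1\<^sub>m (Suc n)" "col W 0 = u"
    using orthogonal_with_first_col[OF u] by auto
  let ?WT = "transpose_mat W"
  define A' where "A' = ?WT * A * W"
  have WT: "?WT \<in> carrier_mat (Suc n) (Suc n)" using W by simp
  have A': "A' \<in> carrier_mat (Suc n) (Suc n)" unfolding A'_def using A W by auto
  have sym': "transpose_mat A' = A'"
    unfolding A'_def using A W sym
    by (simp add: transpose_mult[where n = "Suc n" and nr = "Suc n" and nc = "Suc n"] assoc_mult_mat[where n\<^sub>1 = "Suc n" and n\<^sub>2 = "Suc n" and n\<^sub>3 = "Suc n" and n\<^sub>4 = "Suc n"])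
  \<comment> \<open>\<open>A\<close> only rescales column 0 of \<open>W\<close>, and the other
    columns are orthogonal to it.\<close>
  have col0: "A' $$ (i, 0) = 0" if i: "i > 0" "i < Suc n" for i
  proof -
    have "A' $$ (i, 0) = (?WT * (A * W)) $$ (i, 0)"
      unfolding A'_def using A W by (simp add: assoc_mult_mat[where n\<^sub>1 = "Suc n" and n\<^sub>2 = "Suc n" and n\<^sub>3 = "Suc n" and n\<^sub>4 = "Suc n"])
    also have "\<dots> = col W i \<bullet> col (A * W) 0" using A W i by simp
    also have "col (A * W) 0 = A *\<^sub>v u"
      unfolding W(3)[symmetric] by (rule col_mult2[OF A W(1)]) simp
    also have "col W i \<bullet> (A *\<^sub>v u) = k * (col W i \<bullet> col W 0)"
      unfolding Au W(3) using u W i by (intro scalar_prod_smult_distrib) auto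
    also have "col W i \<bullet> col W 0 = (?WT * W) $$ (i, 0)" using W(1) i by simp
    also have "\<dots> = 0" unfolding W(2) using i by simp
    finally show ?thesis by simp
  qed
  obtain A1 A2 A3 A4 where sb: "split_block A' 1 1 = (A1, A2, A3, A4)"
    by (metis prod_cases4)
  have blocks: "A1 \<in> carrier_mat 1 1" "A2 \<in> carrier_mat 1 n" "A3 \<in> carrier_mat n 1" "A4 \<in> carrier_mat n n"
    "A' = four_block_mat A1 A2 A3 A4"
    using split_block[OF sb, of n n] A' by auto
  have A3: "A3 = 0\<^sub>m n 1"
    using sb A' col0 by (intro eq_matI) (auto simp: split_block_def Let_def)
  have A2: "A2 = 0\<^sub>m 1 n"
  proof (rule eq_matI)
    fix i j assume ij: "i < dim_row (0\<^sub>m 1 n :: real mat)" "j < dim_col (0\<^sub>m 1 n :: real mat)"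
    have "A2 $$ (i, j) = A' $$ (i, Suc j)"
      using ij sb A' by (auto simp: split_block_def Let_def)
    also have "\<dots> = A' $$ (Suc j, i)"
      using arg_cong[OF sym', of "\<lambda>B. B $$ (i, Suc j)"] ij A' by simp
    finally show "A2 $$ (i, j) = 0\<^sub>m 1 n $$ (i, j)" using ij col0 by simp
  qed (use blocks in auto)
  have "transpose_mat A4 = A4"
  proof (rule eq_matI)
    fix i j assume ij: "i < dim_row A4" "j < dim_col A4"
    have entry: "A4 $$ (i, j) = A' $$ (Suc i, Suc j)" if "i < n" "j < n" for i j
      using that sb A' by (auto simp: split_block_def Let_def)
    show "transpose_mat A4 $$ (i, j) = A4 $$ (i, j)"
      using ij blocks(4) arg_cong[OF sym', of "\<lambda>B. B $$ (Suc i, Suc j)"] A' by (simp add: entry)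
  qed (use blocks in auto)
  then obtain Q where Q: "Q \<in> carrier_mat n n" "transpose_mat Q * Q = 1\<^sub>m n"
    "diagonal_mat (transpose_mat Q * A4 * Q)"
    using Suc.IH[OF blocks(4)] by blast
  define R where "R = four_block_mat (1\<^sub>m 1) (0\<^sub>m 1 n) (0\<^sub>m n 1) Q"
  have R: "R \<in> carrier_mat (Suc n) (Suc n)"
    unfolding R_def using four_block_carrier_mat[OF one_carrier_mat[of 1] Q(1)] by simp
  have RT: "transpose_mat R = four_block_mat (1\<^sub>m 1) (0\<^sub>m 1 n) (0\<^sub>m n 1) (transpose_mat Q)"
    unfolding R_def by (subst transpose_four_block_mat[OF _ _ _ Q(1)]) auto
  have RTR: "transpose_mat R * R = 1\<^sub>m (Suc n)"
    unfolding RT unfolding R_def using Q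
    by (subst mult_four_block_mat[of _ 1 1 _ n _ n _ _ 1 _ n]) auto
  have "transpose_mat R * A' * R = four_block_mat A1 (0\<^sub>m 1 n) (0\<^sub>m n 1) (transpose_mat Q * A4 * Q)"
    unfolding RT unfolding R_def blocks(5) A2 A3 using Q blocks
    by (subst mult_four_block_mat[of _ 1 1 _ n _ n _ _ 1 _ n],
        simp_all)+
  moreover have "diagonal_mat (four_block_mat A1 (0\<^sub>m 1 n) (0\<^sub>m n 1) (transpose_mat Q * A4 * Q))"
    using blocks Q by (auto simp: diagonal_mat_def)
  ultimately have dR: "diagonal_mat (transpose_mat R * A' * R)" by simp
  have RTc: "transpose_mat R \<in> carrier_mat (Suc n) (Suc n)" using R by simp
  note assoc = assoc_mult_mat[where n\<^sub>1 = "Suc n" and n\<^sub>2 = "Suc n" and n\<^sub>3 = "Suc n" and n\<^sub>4 = "Suc n"]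
  have PT: "transpose_mat (W * R) = transpose_mat R * ?WT"
    by (rule transpose_mult[OF W(1) R])
  have "transpose_mat (W * R) * (W * R) = transpose_mat R * (?WT * W * R)"
    unfolding PT using W(1) WT R RTc by (simp add: assoc)
  hence "transpose_mat (W * R) * (W * R) = 1\<^sub>m (Suc n)"
    using R RTR by (simp add: W(2))
  moreover have "transpose_mat (W * R) * A * (W * R) = transpose_mat R * A' * R"
    unfolding PT A'_def using W(1) WT R RTc A by (simp add: assoc)
  ultimately show ?case
    using W R dR by (intro bexI[of _ "W * R"]) auto
qed

text \<open>Turns the algebraic multiplicities in \<open>trace_norm\<close> into counts of diagonal
  positions.\<close>

lemma order_prod_linear:
  fixes d :: "nat \<Rightarrow> real"
  shows "order a (\<Prod>i<n. [:- d i, 1:]) = card {i. i < n \<and> d i = a}"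
proof (induction n)
  case (Suc n)
  have "(\<Prod>i<n. [:- d i, 1:]) \<noteq> 0" by simp
  hence "order a ((\<Prod>i<n. [:- d i, 1:]) * [:- d n, 1:])
      = order a (\<Prod>i<n. [:- d i, 1:]) + order a [:- d n, 1:]"
    by (intro order_mult no_zero_divisors) auto
  moreover have "order a [:- d n, 1:] = (if d n = a then 1 else 0)"
    using order_power_n_n[of "d n" 1] by (auto simp: order_0I)
  moreover have "{i. i < Suc n \<and> d i = a} = (if d n = a then insert n else id) {i. i < n \<and> d i = a}"
    by (auto simp: less_Suc_eq)
  ultimately show ?case using Suc by simp
qed simp

text \<open>Conjugation by \<open>P\<close> preserves the characteristic polynomial, and a diagonal
  matrix is triangular, so the polynomial splits over the diagonal entries. Grouping equal entries
  recovers the sum over eigenvalues.\<close>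

lemma trace_norm_eq_sum:
  assumes f: "f \<in> carrier_mat m n"
    and P: "P \<in> carrier_mat n n" "transpose_mat P * P = 1\<^sub>m n"
    and diag: "diagonal_mat (transpose_mat P * (transpose_mat f * f) * P)"
  shows "trace_norm f = (\<Sum>i<n. sqrt ((transpose_mat P * (transpose_mat f * f) * P) $$ (i, i)))"
proof -
  define G where "G = transpose_mat f * f"
  define D where "D = transpose_mat P * G * P"
  define d where "d i = D $$ (i, i)" for i
  have G: "G \<in> carrier_mat n n" unfolding G_def using f by simp
  have PT: "transpose_mat P \<in> carrier_mat n n" using P by simp
  have D: "D \<in> carrier_mat n n" unfolding D_def using G P by simp
  note assoc = assoc_mult_mat[where n\<^sub>1 = n and n\<^sub>2 = n and n\<^sub>3 = n and n\<^sub>4 = n]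
  have PP: "P * transpose_mat P = 1\<^sub>m n"
    by (rule mat_mult_left_right_inverse[OF PT P])
  have "P * D * transpose_mat P = (P * transpose_mat P) * G * (P * transpose_mat P)"
    unfolding D_def using P(1) PT G by (simp add: assoc)
  hence "similar_mat_wit G D P (transpose_mat P)"
    using PP P PT G D by (intro similar_mat_witI) auto
  hence "char_poly G = char_poly D"
    by (intro char_poly_similar) (auto simp: similar_mat_def)
  also have "upper_triangular D"
    using diag D by (auto simp: upper_triangular_def diagonal_mat_def D_def G_def)
  hence "char_poly D = (\<Prod>a\<leftarrow>diag_mat D. [:- a, 1:])"
    by (rule char_poly_upper_triangular[OF D])
  also have "\<dots> = (\<Prod>i<n. [:- d i, 1:])"
    using D by (simp add: diag_mat_def d_def o_def prod.distinct_set_conv_list[symmetric]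
        flip: atLeast0LessThan atLeast_upt)
  finally have cp: "char_poly G = (\<Prod>i<n. [:- d i, 1:])" .
  have ev: "{k. eigenvalue G k} = d ` {..<n}"
    unfolding eigenvalue_root_char_poly[OF G] cp by (auto simp: poly_prod)
  have "trace_norm f = (\<Sum>k\<in>d ` {..<n}. real (card {i. i < n \<and> d i = k}) * sqrt k)"
    unfolding trace_norm_def G_def[symmetric] Let_def ev cp order_prod_linear ..
  also have "\<dots> = (\<Sum>k\<in>d ` {..<n}. \<Sum>i\<in>{i\<in>{..<n}. d i = k}. sqrt (d i))"
    by (intro sum.cong refl) simp
  also have "\<dots> = (\<Sum>i<n. sqrt (d i))"
    by (intro sum.image_gen[symmetric]) simp
  finally show ?thesis by (simp add: d_def D_def G_def)
qed

text \<open>With \<open>P\<close> diagonalizing \<open>f\<^sup>T f\<close>, the columns of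
  \<open>f * P\<close> have the singular values of \<open>f\<close> as norms, while those of
  \<open>M * P\<close> are images of unit vectors under \<open>M\<close>. Cauchy-Schwarz column by
  column then gives the bound.\<close>

lemma mat_inner_le_trace_norm_spectral_norm:
  assumes f: "f \<in> carrier_mat m n" and M: "M \<in> carrier_mat m n"
  shows "mat_inner f M \<le> trace_norm f * spectral_norm M"
proof -
  have fT: "transpose_mat f \<in> carrier_mat n m" using f by simp
  have G: "transpose_mat f * f \<in> carrier_mat n n" using f by simp
  have "transpose_mat (transpose_mat f * f) = transpose_mat f * f"
    using f by (subst transpose_mult[where n = m and nr = n and nc = n]) auto
  then obtain P where P: "P \<in> carrier_mat n n" "transpose_mat P * P = 1\<^sub>m n"
    and diag: "diagonal_mat (transpose_mat P * (transpose_mat f * f) * P)"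
    using symmetric_orthogonally_diagonalizable[OF G] by blast
  have PT: "transpose_mat P \<in> carrier_mat n n" using P by simp
  have PP: "P * transpose_mat P = 1\<^sub>m n"
    by (rule mat_mult_left_right_inverse[OF PT P])
  have fP: "f * P \<in> carrier_mat m n" and MP: "M * P \<in> carrier_mat m n" using f M P by auto
  have "mat_inner f M = (\<Sum>j<n. col (f * P) j \<bullet> col (M * P) j)"
    by (simp add: mat_inner_mult_orthogonal[OF f M P(1) PP] flip: mat_inner_sum[OF fP MP])
  also have "\<dots> \<le> (\<Sum>j<n. sqrt ((transpose_mat P * (transpose_mat f * f) * P) $$ (j, j)) * spectral_norm M)"
  proof (rule sum_mono)
    fix j assume "j \<in> {..<n}"
    hence j: "j < n" by simp
    have "col P j \<bullet> col P j = (transpose_mat P * P) $$ (j, j)" using j P(1) by simp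
    hence colP: "euclid_norm (col P j) = 1" unfolding P(2) euclid_norm_def using j by simp
    have "transpose_mat P * (transpose_mat f * f) * P = transpose_mat (f * P) * (f * P)"
      unfolding transpose_mult[OF f P(1)] assoc_mult_mat[OF mult_carrier_mat[OF PT fT] f P(1), symmetric]
        assoc_mult_mat[OF PT fT f] ..
    hence "(transpose_mat P * (transpose_mat f * f) * P) $$ (j, j) = col (f * P) j \<bullet> col (f * P) j"
      using j fP P by simp
    hence nf: "euclid_norm (col (f * P) j) = sqrt ((transpose_mat P * (transpose_mat f * f) * P) $$ (j, j))"
      by (simp add: euclid_norm_def)
    have "euclid_norm (col (M * P) j) = euclid_norm (M *\<^sub>v col P j)"
      by (simp only: col_mult2[OF M P(1) j])
    also have "\<dots> \<le> spectral_norm M"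
      using M P j colP by (intro euclid_norm_le_spectral_norm) auto
    finally have nM: "euclid_norm (col (M * P) j) \<le> spectral_norm M" .
    have "col (f * P) j \<bullet> col (M * P) j \<le> euclid_norm (col (f * P) j) * euclid_norm (col (M * P) j)"
      using f M P by (intro scalar_prod_le_euclid_norm) auto
    also have "\<dots> \<le> euclid_norm (col (f * P) j) * spectral_norm M"
      by (intro mult_left_mono nM) simp
    finally show "col (f * P) j \<bullet> col (M * P) j
        \<le> sqrt ((transpose_mat P * (transpose_mat f * f) * P) $$ (j, j)) * spectral_norm M"
      unfolding nf .
  qed
  also have "\<dots> = trace_norm f * spectral_norm M"
    unfolding trace_norm_eq_sum[OF f P diag] by (simp add: sum_distrib_right)
  finally show ?thesis .
qed

section \<open>Random sign matrices\<close>

text \<open>The two power series are compared term by term, using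
  \<open>2 ^ k * fact k \<le> fact (2 * k)\<close>.\<close>

lemma cosh_le_exp_half_sq: "cosh x \<le> exp (x\<^sup>2 / 2)" for x :: real
proof -
  have fact2: "2 ^ k * fact k \<le> (fact (2 * k) :: real)" for k
  proof (induction k)
    case (Suc k)
    have "2 ^ Suc k * fact (Suc k) = 2 * real (Suc k) * (2 ^ k * fact k)"
      by (simp add: algebra_simps)
    also have "\<dots> \<le> 2 * real (Suc k) * fact (2 * k)"
      by (intro mult_left_mono Suc) simp
    also have "\<dots> \<le> (2 * real k + 1) * (2 * real (Suc k) * fact (2 * k))"
      using mult_right_mono[of 1 "2 * real k + 1" "2 * real (Suc k) * fact (2 * k)"] by simp
    also have "\<dots> = fact (2 * Suc k)"
      by (simp add: algebra_simps)
    finally show ?case .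
  qed simp
  let ?f = "\<lambda>n. if even n then x ^ n /\<^sub>R fact n else 0"
  \<comment> \<open>The odd terms vanish, so the series may be summed along the even
    indices.\<close>
  have "(\<lambda>k. ?f (2 * k)) sums cosh x \<longleftrightarrow> ?f sums cosh x"
    by (rule sums_mono_reindex) (auto simp: strict_mono_def elim!: evenE)
  hence 1: "(\<lambda>k. ?f (2 * k)) sums cosh x"
    using cosh_converges by blast
  have 2: "(\<lambda>k. (x\<^sup>2 / 2) ^ k /\<^sub>R fact k) sums exp (x\<^sup>2 / 2)"
    by (rule exp_converges)
  show ?thesis
  proof (rule sums_le[OF _ 1 2])
    fix k
    have "(x\<^sup>2) ^ k / fact (2 * k) \<le> (x\<^sup>2) ^ k / (2 ^ k * fact k)"
      by (intro divide_left_mono fact2) auto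
    moreover have "?f (2 * k) = (x\<^sup>2) ^ k / fact (2 * k)"
      by (simp add: power_mult[symmetric] divide_inverse mult.commute)
    moreover have "(x\<^sup>2 / 2) ^ k /\<^sub>R fact k = (x\<^sup>2) ^ k / (2 ^ k * fact k)"
      by (simp only: real_scaleR_def power_divide) (simp add: divide_inverse)
    ultimately show "?f (2 * k) \<le> (x\<^sup>2 / 2) ^ k /\<^sub>R fact k" by simp
  qed
qed

text \<open>Finite support makes every real function of the signs integrable, which discharges all
  integrability conditions on such expectations.\<close>

lemma finite_set_rademacher: "finite I \<Longrightarrow> finite (set_pmf (rademacher I))"
  unfolding rademacher_def by (intro finite_subset[OF set_Pi_pmf_subset'] finite_PiE_dflt) auto

lemma expectation_sign:
  fixes g :: "real \<Rightarrow> real"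
  shows "measure_pmf.expectation (pmf_of_set {-1, 1}) g = (g (-1) + g 1) / 2"
  by (subst integral_pmf_of_set) auto

text \<open>Independence factors the exponential, and each sign contributes a \<open>cosh\<close>.
  This is the sub-Gaussian bound behind the union bound.\<close>

lemma rademacher_mgf_le:
  assumes "finite I"
  shows "measure_pmf.expectation (rademacher I) (\<lambda>\<epsilon>. exp (\<Sum>t\<in>I. \<epsilon> t * a t))
    \<le> exp ((\<Sum>t\<in>I. (a t)\<^sup>2) / 2)"
proof -
  have "measure_pmf.expectation (rademacher I) (\<lambda>\<epsilon>. exp (\<Sum>t\<in>I. \<epsilon> t * a t))
      = measure_pmf.expectation (rademacher I) (\<lambda>\<epsilon>. \<Prod>t\<in>I. exp (\<epsilon> t * a t))"
    by (simp add: exp_sum assms)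
  also have "\<dots> = (\<Prod>t\<in>I. measure_pmf.expectation (pmf_of_set {-1, 1}) (\<lambda>s. exp (s * a t)))"
    unfolding rademacher_def
    by (rule expectation_prod_Pi_pmf) (auto intro!: integrable_measure_pmf_finite assms)
  also have "\<dots> = (\<Prod>t\<in>I. cosh (a t))"
    unfolding expectation_sign cosh_def by (intro prod.cong refl) (simp add: field_simps)
  also have "\<dots> \<le> (\<Prod>t\<in>I. exp ((a t)\<^sup>2 / 2))"
    by (intro prod_mono conjI cosh_le_exp_half_sq) (simp add: cosh_real_nonneg)
  also have "\<dots> = exp ((\<Sum>t\<in>I. (a t)\<^sup>2) / 2)"
    by (simp add: exp_sum assms sum_divide_distrib)
  finally show ?thesis .
qed

section \<open>Lattice nets of the Euclidean unit ball\<close>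

lemma int_abs_le_square: "\<bar>k\<bar> \<le> k\<^sup>2" for k :: int
  using mult_left_mono[of 1 "\<bar>k\<bar>" "\<bar>k\<bar>"] by (cases "k = 0") (auto simp: power2_eq_square)

lemma sum_half_power_abs_le: "(\<Sum>k\<in>{-int R..int R}. (1 / 2) ^ nat \<bar>k\<bar>) \<le> (3 :: real)"
proof -
  \<comment> \<open>The bound 3, which is 1 plus two geometric series of sum 1, is not inductive by
    itself; the exact value is.\<close>
  have "(\<Sum>k\<in>{-int R..int R}. (1 / 2) ^ nat \<bar>k\<bar>) = 3 - 2 * (1 / 2 :: real) ^ R"
  proof (induction R)
    case (Suc R)
    have "{-int (Suc R)..int (Suc R)} = insert (- int (Suc R)) (insert (int (Suc R)) {-int R..int R})"
      by auto
    thus ?case using Suc by (simp add: nat_add_distrib)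
  qed simp
  thus ?thesis by simp
qed

text \<open>Since \<open>\<bar>k\<bar> \<le> k\<^sup>2\<close> on the integers, each point counted has weight at least one in
  \<open>\<Sum>\<^sub>z 2 ^ (N - \<Sum>\<^sub>i \<bar>z\<^sub>i\<bar>)\<close>, which factorizes over the coordinates.\<close>

lemma card_int_ball_le:
  fixes n N :: nat
  defines "S \<equiv> {z \<in> {..<n} \<rightarrow>\<^sub>E {-int N..int N}. (\<Sum>i<n. (z i)\<^sup>2) \<le> int N}"
  shows "finite S" "real (card S) \<le> 2 ^ N * 3 ^ n"
proof -
  have fin: "finite ({..<n} \<rightarrow>\<^sub>E {-int N..int N})" by (intro finite_PiE) auto
  show "finite S" unfolding S_def using fin by simp
  have "real (card S) = (\<Sum>z\<in>S. 1)" by simp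
  also have "\<dots> \<le> (\<Sum>z\<in>S. 2 ^ N * (\<Prod>i<n. (1 / 2) ^ nat \<bar>z i\<bar>))"
  proof (rule sum_mono)
    fix z assume z: "z \<in> S"
    have "int (\<Sum>i<n. nat \<bar>z i\<bar>) = (\<Sum>i<n. \<bar>z i\<bar>)" by simp
    also have "\<dots> \<le> (\<Sum>i<n. (z i)\<^sup>2)" by (intro sum_mono int_abs_le_square)
    also have "\<dots> \<le> int N" using z by (simp add: S_def)
    finally have "(\<Sum>i<n. nat \<bar>z i\<bar>) \<le> N" by linarith
    hence "(1 / 2 :: real) ^ N \<le> (1 / 2) ^ (\<Sum>i<n. nat \<bar>z i\<bar>)"
      by (intro power_decreasing) auto
    also have "\<dots> = (\<Prod>i<n. (1 / 2) ^ nat \<bar>z i\<bar>)" by (simp add: power_sum)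
    finally show "1 \<le> 2 ^ N * (\<Prod>i<n. (1 / 2 :: real) ^ nat \<bar>z i\<bar>)"
      by (simp add: power_divide field_simps)
  qed
  also have "\<dots> \<le> (\<Sum>z\<in>{..<n} \<rightarrow>\<^sub>E {-int N..int N}. 2 ^ N * (\<Prod>i<n. (1 / 2) ^ nat \<bar>z i\<bar>))"
  proof (rule sum_mono2[OF fin])
    show "S \<subseteq> {..<n} \<rightarrow>\<^sub>E {-int N..int N}" by (auto simp: S_def)
  qed (simp add: prod_nonneg)
  also have "\<dots> = 2 ^ N * (\<Prod>i<n. \<Sum>k\<in>{-int N..int N}. (1 / 2) ^ nat \<bar>k\<bar>)"
    by (subst prod_sum_PiE) (auto simp: sum_distrib_left)
  also have "\<dots> \<le> 2 ^ N * (\<Prod>i<n. 3)"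
    by (intro mult_left_mono prod_mono conjI sum_half_power_abs_le sum_nonneg) auto
  finally show "real (card S) \<le> 2 ^ N * 3 ^ n" by simp
qed

text \<open>Rounding towards zero rather than to the nearest integer never increases absolute
  values, so rounded points of a ball stay in that ball. The price is an error of up to 1 per
  coordinate.\<close>

lemma round_towards_zero:
  fixes a :: real
  obtains z :: int where "\<bar>a - of_int z\<bar> \<le> 1" "\<bar>of_int z\<bar> \<le> \<bar>a\<bar>"
proof (cases "a \<ge> 0")
  case True
  hence "0 \<le> \<lfloor>a\<rfloor>" by simp
  with True show ?thesis by (intro that[of "\<lfloor>a\<rfloor>"]) linarith+
next
  case False
  hence "\<lceil>a\<rceil> \<le> 0" by (simp add: ceiling_le_iff)
  with False show ?thesis by (intro that[of "\<lceil>a\<rceil>"]) linarith+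
qed

text \<open>The grid of mesh \<open>1 / (2 \<surd>n)\<close> contains a \<open>1/2\<close>-net of the unit ball.\<close>

lemma unit_ball_half_net:
  obtains N :: "real Matrix.vec set"
  where "finite N" "real (card N) \<le> 48 ^ n" "N \<subseteq> carrier_vec n"
    "\<And>v. v \<in> N \<Longrightarrow> euclid_norm v \<le> 1"
    "\<And>u. u \<in> carrier_vec n \<Longrightarrow> euclid_norm u \<le> 1 \<Longrightarrow> \<exists>v\<in>N. euclid_norm (u - v) \<le> 1 / 2"
proof -
  \<comment> \<open>Integer points of norm at most \<open>r\<close>, the square of \<open>r\<close>
    being \<open>4 * n\<close>. Division by \<open>r\<close> puts them into the unit ball, and a
    rounding error of 1 in each of the \<open>n\<close> coordinates becomes a distance of at most
    \<open>sqrt n / r\<close>, which is 1/2 for positive \<open>n\<close>.\<close>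
  define S where "S = {z \<in> {..<n} \<rightarrow>\<^sub>E {-int (4 * n)..int (4 * n)}. (\<Sum>i<n. (z i)\<^sup>2) \<le> int (4 * n)}"
  define r where "r = 2 * sqrt (real n)"
  define e where "e z = Matrix.vec n (\<lambda>i. of_int (z i) / r)" for z :: "nat \<Rightarrow> int"
  have norm_sq: "(euclid_norm v)\<^sup>2 = (\<Sum>i<n. (v $ i)\<^sup>2)" if "v \<in> carrier_vec n" for v
    using that by (simp add: euclid_norm_L2 L2_set_def sum_nonneg)
  have r2: "r\<^sup>2 = 4 * real n" by (simp add: r_def power_mult_distrib)
  have "finite (e ` S)" unfolding S_def by (intro finite_imageI card_int_ball_le)
  moreover have "real (card (e ` S)) \<le> 48 ^ n"
  proof -
    have "real (card (e ` S)) \<le> real (card S)"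
      unfolding S_def by (intro of_nat_mono card_image_le card_int_ball_le)
    also have "\<dots> \<le> 2 ^ (4 * n) * 3 ^ n" unfolding S_def by (rule card_int_ball_le)
    \<comment> \<open>Here 48 arises as \<open>2 ^ 4 * 3\<close>.\<close>
    also have "\<dots> = 48 ^ n" by (simp add: power_mult flip: power_mult_distrib)
    finally show ?thesis .
  qed
  moreover have "e ` S \<subseteq> carrier_vec n" by (auto simp: e_def)
  moreover have "euclid_norm v \<le> 1" if v: "v \<in> e ` S" for v
  proof -
    obtain z where z: "z \<in> S" "v = e z" using v by auto
    have "real_of_int (\<Sum>i<n. (z i)\<^sup>2) \<le> real_of_int (int (4 * n))"
      using z(1) unfolding S_def by (intro of_int_le_iff[THEN iffD2]) simp
    hence le: "(\<Sum>i<n. (real_of_int (z i))\<^sup>2) \<le> r\<^sup>2" by (simp add: r2)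
    have "(euclid_norm v)\<^sup>2 = (\<Sum>i<n. (real_of_int (z i))\<^sup>2) / r\<^sup>2"
      unfolding z(2) by (subst norm_sq) (simp_all add: e_def power_divide sum_divide_distrib)
    also have "\<dots> \<le> 1" using le by (simp add: divide_le_eq_1)
    finally show ?thesis by (simp add: abs_square_le_1)
  qed
  moreover have "\<exists>v\<in>e ` S. euclid_norm (u - v) \<le> 1 / 2"
    if u: "u \<in> carrier_vec n" "euclid_norm u \<le> 1" for u
  proof -
    have "\<forall>i. \<exists>z. \<bar>r * u $ i - of_int z\<bar> \<le> 1 \<and> \<bar>of_int z\<bar> \<le> \<bar>r * u $ i\<bar>"
      by (metis round_towards_zero)
    then obtain z0 where z0: "\<And>i. \<bar>r * u $ i - of_int (z0 i)\<bar> \<le> 1"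
      "\<And>i. \<bar>of_int (z0 i)\<bar> \<le> \<bar>r * u $ i\<bar>" by metis
    define z where "z = restrict z0 {..<n}"
    have zz0: "z i = z0 i" if "i < n" for i using that by (simp add: z_def)
    have "real_of_int (\<Sum>i<n. (z i)\<^sup>2) = (\<Sum>i<n. (real_of_int (z0 i))\<^sup>2)" by (simp add: zz0)
    also have "\<dots> \<le> (\<Sum>i<n. (r * u $ i)\<^sup>2)"
      by (intro sum_mono) (simp add: abs_le_square_iff[symmetric] z0)
    also have "\<dots> = r\<^sup>2 * (euclid_norm u)\<^sup>2"
      using u by (simp add: norm_sq power_mult_distrib sum_distrib_left)
    also have "\<dots> \<le> r\<^sup>2 * 1"
      using u by (intro mult_left_mono) (auto simp: abs_square_le_1)
    also have "\<dots> = real_of_int (int (4 * n))" by (simp add: r2)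
    finally have sum_le: "(\<Sum>i<n. (z i)\<^sup>2) \<le> int (4 * n)" by (simp only: of_int_le_iff)
    \<comment> \<open>For integers the norm bound already implies the box constraint in
      \<open>S\<close>.\<close>
    have "\<bar>z i\<bar> \<le> int (4 * n)" if "i < n" for i
    proof -
      have "\<bar>z i\<bar> \<le> (z i)\<^sup>2"
        by (rule int_abs_le_square)
      also have "(z i)\<^sup>2 \<le> (\<Sum>i<n. (z i)\<^sup>2)"
        using that by (intro member_le_sum) auto
      finally show ?thesis using sum_le by linarith
    qed
    hence "z i \<in> {- int (4 * n)..int (4 * n)}" if "i < n" for i
      using that by (fastforce simp: abs_le_iff)
    hence "z \<in> {..<n} \<rightarrow>\<^sub>E {- int (4 * n)..int (4 * n)}"
      by (intro PiE_I) (auto simp: z_def)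
    hence "z \<in> S" using sum_le by (simp add: S_def)
    have "euclid_norm (u - e z) \<le> 1 / 2"
    \<comment> \<open>For \<open>n = 0\<close> the scale \<open>r\<close> is 0, so this case cannot
      divide by it; both vectors are empty.\<close>
    proof (cases "n = 0")
      case True
      thus ?thesis using u by (simp add: euclid_norm_L2 e_def)
    next
      case False
      hence r: "r > 0" by (simp add: r_def)
      have "(euclid_norm (u - e z))\<^sup>2 = (\<Sum>i<n. ((r * u $ i - of_int (z0 i)) / r)\<^sup>2)"
        using u r by (subst norm_sq) (auto simp: e_def zz0 diff_divide_distrib intro!: sum.cong)
      also have "\<dots> \<le> (\<Sum>i<n. (1 / r)\<^sup>2)"
        using r by (intro sum_mono) (simp add: power_divide divide_right_mono abs_square_le_1 z0)
      also have "\<dots> = (1 / 2)\<^sup>2" using False r by (simp add: power_divide r2)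
      finally show ?thesis by (rule power2_le_imp_le) simp
    qed
    with \<open>z \<in> S\<close> show ?thesis by blast
  qed
  ultimately show ?thesis by (rule that)
qed

text \<open>Each net costs a factor 2. Testing against \<open>M\<close> controls the norm of
  \<open>X *\<^sub>v u\<close> for \<open>u\<close> in \<open>N\<close>, and approximating a general
  vector by \<open>N\<close> then controls the spectral norm.\<close>

lemma spectral_norm_le_net:
  assumes X: "X \<in> carrier_mat m n"
    and M: "M \<subseteq> carrier_vec m"
    and M_net: "\<And>w. w \<in> carrier_vec m \<Longrightarrow> euclid_norm w \<le> 1 \<Longrightarrow> \<exists>v\<in>M. euclid_norm (w - v) \<le> 1 / 2"
    and N: "N \<subseteq> carrier_vec n"
    and N_net: "\<And>w. w \<in> carrier_vec n \<Longrightarrow> euclid_norm w \<le> 1 \<Longrightarrow> \<exists>v\<in>N. euclid_norm (w - v) \<le> 1 / 2"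
    and c: "\<And>v u. v \<in> M \<Longrightarrow> u \<in> N \<Longrightarrow> v \<bullet> (X *\<^sub>v u) \<le> c"
  shows "spectral_norm X \<le> 4 * c"
proof -
  have on_net: "euclid_norm (X *\<^sub>v u) \<le> 2 * c" if u: "u \<in> N" for u
  proof -
    define w where "w = X *\<^sub>v u"
    \<comment> \<open>For \<open>w = 0\<close> the inverse is 0 by convention and \<open>v\<close>
      is the zero vector, still in the unit ball.\<close>
    define v where "v = inverse (euclid_norm w) \<cdot>\<^sub>v w"
    have w: "w \<in> carrier_vec m" using X u N unfolding w_def by auto
    have v: "v \<in> carrier_vec m" using w by (simp add: v_def)
    have "euclid_norm v \<le> 1"
      by (cases "euclid_norm w = 0") (auto simp: v_def euclid_norm_smult)
    then obtain v' where v': "v' \<in> M" "euclid_norm (v - v') \<le> 1 / 2"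
      using M_net v by blast
    have v'c: "v' \<in> carrier_vec m" using v' M by auto
    have "euclid_norm w = v \<bullet> w"
      using euclid_norm_sq[of w] unfolding v_def
      by (cases "euclid_norm w = 0") (auto simp: power2_eq_square field_simps)
    also have "\<dots> = v' \<bullet> w + (v - v') \<bullet> w"
      using v v'c w by (simp add: minus_scalar_prod_distrib)
    also have "(v - v') \<bullet> w \<le> euclid_norm (v - v') * euclid_norm w"
      using v v'c w by (intro scalar_prod_le_euclid_norm) auto
    also have "\<dots> \<le> 1 / 2 * euclid_norm w"
      by (intro mult_right_mono v') simp
    also have "v' \<bullet> w \<le> c" unfolding w_def using c v' u by blast
    finally show ?thesis unfolding w_def by simp
  qed
  \<comment> \<open>The approximation error is again measured by the spectral norm, but with factor
    1/2, so it can be absorbed on the left.\<close>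
  have "spectral_norm X \<le> 2 * c + spectral_norm X / 2"
  proof (rule spectral_norm_leI)
    fix u assume "u \<in> carrier_vec (dim_col X)" and u1: "euclid_norm u \<le> 1"
    hence u: "u \<in> carrier_vec n" using X by simp
    obtain u' where u': "u' \<in> N" "euclid_norm (u - u') \<le> 1 / 2"
      using N_net[OF u u1] by blast
    have u'c: "u' \<in> carrier_vec n" using u' N by auto
    have "X *\<^sub>v u = X *\<^sub>v u' + X *\<^sub>v (u - u')"
      unfolding mult_minus_distrib_mat_vec[OF X u u'c] using X by (intro eq_vecI) auto
    hence "euclid_norm (X *\<^sub>v u) \<le> euclid_norm (X *\<^sub>v u') + euclid_norm (X *\<^sub>v (u - u'))"
      using euclid_norm_triangle[of "X *\<^sub>v u'" m "X *\<^sub>v (u - u')"] X u u'c by auto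
    also have "euclid_norm (X *\<^sub>v (u - u')) \<le> spectral_norm X * euclid_norm (u - u')"
      using X u u'c by (intro euclid_norm_mult_mat_vec_le) auto
    also have "\<dots> \<le> spectral_norm X * (1 / 2)"
      by (intro mult_left_mono u' spectral_norm_nonneg)
    also have "euclid_norm (X *\<^sub>v u') \<le> 2 * c" by (rule on_net[OF u'(1)])
    finally show "euclid_norm (X *\<^sub>v u) \<le> 2 * c + spectral_norm X / 2" by simp
  qed
  thus ?thesis by simp
qed

section \<open>The expected spectral norm of a random sign matrix\<close>

lemma entry_mat_carrier [simp]: "entry_mat m n p \<in> carrier_mat m n"
  by (simp add: entry_mat_def)

lemma signed_sum_carrier [simp]: "signed_sum m n T x \<epsilon> \<in> carrier_mat m n"
  by (simp add: signed_sum_def)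

text \<open>Exhibits the bilinear form as a linear combination of the signs, the shape required by
  \<open>rademacher_mgf_le\<close>.\<close>

lemma signed_sum_bilinear:
  assumes v: "v \<in> carrier_vec m" and u: "u \<in> carrier_vec n"
    and loc: "\<And>t. t < T \<Longrightarrow> loc t \<in> {..<m} \<times> {..<n}"
  shows "v \<bullet> (signed_sum m n T (\<lambda>t. entry_mat m n (loc t)) \<epsilon> *\<^sub>v u)
    = (\<Sum>t<T. \<epsilon> t * (v $ fst (loc t) * u $ snd (loc t)))"
proof -
  have "v \<bullet> (signed_sum m n T (\<lambda>t. entry_mat m n (loc t)) \<epsilon> *\<^sub>v u)
      = (\<Sum>i<m. v $ i * (\<Sum>j<n. (\<Sum>t<T. \<epsilon> t * (if (i, j) = loc t then 1 else 0)) * u $ j))"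
    using v u by (auto simp: signed_sum_def entry_mat_def scalar_prod_def atLeast0LessThan intro!: sum.cong)
  also have "\<dots> = (\<Sum>q\<in>{..<m} \<times> {..<n}. \<Sum>t<T. \<epsilon> t * (v $ fst q * u $ snd q) * (if q = loc t then 1 else 0))"
    unfolding sum.cartesian_product' sum_distrib_left sum_distrib_right
    by (intro sum.cong refl) (simp add: mult_ac)
  also have "\<dots> = (\<Sum>t<T. \<Sum>q\<in>{..<m} \<times> {..<n}. \<epsilon> t * (v $ fst q * u $ snd q) * (if q = loc t then 1 else 0))"
    by (rule sum.swap)
  also have "\<dots> = (\<Sum>t<T. \<epsilon> t * (v $ fst (loc t) * u $ snd (loc t)))"
    using loc by (intro sum.cong refl) (simp add: if_distrib[where f = "\<lambda>x. _ * x"] cong: if_cong)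
  finally show ?thesis .
qed

text \<open>The exponential of the norm is at most the sum of the exponentials of the bilinear form
  over all net pairs. Distinct locations keep the coefficients of each form within the unit sphere
  or ball; if every round used the same entry, the norm would be the modulus of a sum of
  \<open>T\<close> signs, of order \<open>sqrt T\<close>.\<close>

lemma expectation_spectral_norm_le:
  assumes loc: "\<And>t. t < T \<Longrightarrow> loc t \<in> {..<m} \<times> {..<n}" and inj: "inj_on loc {..<T}"
  shows "measure_pmf.expectation (rademacher {..<T})
      (\<lambda>\<epsilon>. spectral_norm (signed_sum m n T (\<lambda>t. entry_mat m n (loc t)) \<epsilon>))
    \<le> 4 * (ln 48 + 1 / 2) * sqrt (real (m + n))"
proof -
  let ?X = "signed_sum m n T (\<lambda>t. entry_mat m n (loc t))"
  let ?E = "measure_pmf.expectation (rademacher {..<T})"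
  have int: "integrable (measure_pmf (rademacher {..<T})) f" for f :: "_ \<Rightarrow> real"
    by (intro integrable_measure_pmf_finite finite_set_rademacher) simp
  obtain M where M: "finite M" "real (card M) \<le> 48 ^ m" "M \<subseteq> carrier_vec m"
    "\<And>v. v \<in> M \<Longrightarrow> euclid_norm v \<le> 1"
    "\<And>u. u \<in> carrier_vec m \<Longrightarrow> euclid_norm u \<le> 1 \<Longrightarrow> \<exists>v\<in>M. euclid_norm (u - v) \<le> 1 / 2"
    by (rule unit_ball_half_net[of m]) blast
  obtain N where N: "finite N" "real (card N) \<le> 48 ^ n" "N \<subseteq> carrier_vec n"
    "\<And>v. v \<in> N \<Longrightarrow> euclid_norm v \<le> 1"
    "\<And>u. u \<in> carrier_vec n \<Longrightarrow> euclid_norm u \<le> 1 \<Longrightarrow> \<exists>v\<in>N. euclid_norm (u - v) \<le> 1 / 2"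
    by (rule unit_ball_half_net[of n]) blast
  show ?thesis
  \<comment> \<open>The scale \<open>l\<close> of the exponent would be 0 for an empty
    matrix.\<close>
  proof (cases "m + n = 0")
    case True
    have "spectral_norm (?X \<epsilon>) \<le> 4 * 0" for \<epsilon>
      by (rule spectral_norm_le_net[OF _ M(3,5) N(3,5)]) (use M N True in \<open>auto simp: scalar_prod_def\<close>)
    hence "?E (\<lambda>\<epsilon>. spectral_norm (?X \<epsilon>)) \<le> ?E (\<lambda>_. 0)"
      by (intro integral_mono int) simp
    thus ?thesis using True by simp
  next
    case False
    \<comment> \<open>The method bounds a quarter of the expected norm by
      \<open>(m + n) * ln 48 / l + l / 2\<close>; this \<open>l\<close> gives both terms the order
      \<open>sqrt (m + n)\<close>.\<close>
    define l where "l = sqrt (real (m + n))"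
    have l: "l > 0" "l\<^sup>2 = real (m + n)" using False by (auto simp: l_def)
    \<comment> \<open>\<open>exp b\<close> bounds the number of net pairs times the exponential
      moment of a single pair.\<close>
    define b where "b = real (m + n) * ln 48 + l\<^sup>2 / 2"
    have exp_b: "exp b = 48 ^ m * 48 ^ n * exp (l\<^sup>2 / 2)"
      by (simp add: b_def exp_add exp_of_nat_mult distrib_right)
    have pair: "?E (\<lambda>\<epsilon>. exp (l * (v \<bullet> (?X \<epsilon> *\<^sub>v u)))) \<le> exp (l\<^sup>2 / 2)" if vu: "v \<in> M" "u \<in> N" for v u
    proof -
      define a where "a t = v $ fst (loc t) * u $ snd (loc t)" for t
      have vc: "v \<in> carrier_vec m" and uc: "u \<in> carrier_vec n" using vu M N by auto
      \<comment> \<open>By injectivity each entry occurs at most once, and the sum over all entries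
        factorizes into the two squared norms.\<close>
      have "(\<Sum>t<T. (a t)\<^sup>2) = (\<Sum>q\<in>loc ` {..<T}. (v $ fst q)\<^sup>2 * (u $ snd q)\<^sup>2)"
        by (simp add: sum.reindex[OF inj] a_def power_mult_distrib)
      also have "\<dots> \<le> (\<Sum>q\<in>{..<m} \<times> {..<n}. (v $ fst q)\<^sup>2 * (u $ snd q)\<^sup>2)"
      proof (rule sum_mono2)
        show "loc ` {..<T} \<subseteq> {..<m} \<times> {..<n}" using loc by blast
      qed auto
      also have "\<dots> = (euclid_norm v)\<^sup>2 * (euclid_norm u)\<^sup>2"
        using vc uc by (simp add: euclid_norm_L2 L2_set_def sum_nonneg sum_product sum.cartesian_product')
      also have "\<dots> \<le> 1 * 1"
        using M(4)[OF vu(1)] N(4)[OF vu(2)] by (intro mult_mono) (auto simp: abs_square_le_1)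
      finally have a: "(\<Sum>t<T. (a t)\<^sup>2) \<le> 1" by simp
      have bilin: "v \<bullet> (?X \<epsilon> *\<^sub>v u) = (\<Sum>t<T. \<epsilon> t * (v $ fst (loc t) * u $ snd (loc t)))" for \<epsilon>
        by (rule signed_sum_bilinear[OF vc uc]) (rule loc)
      have "?E (\<lambda>\<epsilon>. exp (l * (v \<bullet> (?X \<epsilon> *\<^sub>v u)))) = ?E (\<lambda>\<epsilon>. exp (\<Sum>t<T. \<epsilon> t * (l * a t)))"
        by (simp add: bilin sum_distrib_left a_def mult.left_commute)
      also have "\<dots> \<le> exp ((\<Sum>t<T. (l * a t)\<^sup>2) / 2)"
        by (rule rademacher_mgf_le) simp
      also have "\<dots> \<le> exp (l\<^sup>2 / 2)"
        using mult_left_mono[OF a, of "l\<^sup>2"] by (simp add: power_mult_distrib flip: sum_distrib_left)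
      finally show ?thesis .
    qed
    have pointwise: "exp (l * (spectral_norm (?X \<epsilon>) / 4)) \<le> (\<Sum>v\<in>M. \<Sum>u\<in>N. exp (l * (v \<bullet> (?X \<epsilon> *\<^sub>v u))))"
      (is "_ \<le> ?S \<epsilon>") for \<epsilon>
    proof -
      have term_le: "exp (l * (v \<bullet> (?X \<epsilon> *\<^sub>v u))) \<le> ?S \<epsilon>" if "v \<in> M" "u \<in> N" for v u
      proof -
        have "exp (l * (v \<bullet> (?X \<epsilon> *\<^sub>v u))) \<le> (\<Sum>u\<in>N. exp (l * (v \<bullet> (?X \<epsilon> *\<^sub>v u))))"
          using that N(1) by (intro member_le_sum) auto
        also have "\<dots> \<le> ?S \<epsilon>"
          using that M(1) by (intro member_le_sum[where f = "\<lambda>v. \<Sum>u\<in>N. exp (l * (v \<bullet> (?X \<epsilon> *\<^sub>v u)))"])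
            (auto intro!: sum_nonneg)
        finally show ?thesis .
      qed
      \<comment> \<open>Approximating the zero vectors shows that the nets are nonempty, so the sum
        is positive and its logarithm usable.\<close>
      obtain v0 u0 where "v0 \<in> M" "u0 \<in> N"
        using M(5)[of "0\<^sub>v m"] N(5)[of "0\<^sub>v n"] by auto
      hence S: "?S \<epsilon> > 0" using term_le by (meson exp_gt_zero less_le_trans)
      have "spectral_norm (?X \<epsilon>) \<le> 4 * (ln (?S \<epsilon>) / l)"
      proof (rule spectral_norm_le_net[OF _ M(3,5) N(3,5)])
        fix v u assume "v \<in> M" "u \<in> N"
        from term_le[OF this] have "l * (v \<bullet> (?X \<epsilon> *\<^sub>v u)) \<le> ln (?S \<epsilon>)"
          using S by (simp add: ln_ge_iff)
        thus "v \<bullet> (?X \<epsilon> *\<^sub>v u) \<le> ln (?S \<epsilon>) / l" using l by (simp add: field_simps)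
      qed auto
      hence "l * (spectral_norm (?X \<epsilon>) / 4) \<le> ln (?S \<epsilon>)" using l by (simp add: field_simps)
      thus ?thesis by (simp only: ln_ge_iff[OF S])
    qed
    have "?E (\<lambda>\<epsilon>. exp (l * (spectral_norm (?X \<epsilon>) / 4))) \<le> ?E ?S"
      by (intro integral_mono int pointwise)
    also have "\<dots> = (\<Sum>v\<in>M. \<Sum>u\<in>N. ?E (\<lambda>\<epsilon>. exp (l * (v \<bullet> (?X \<epsilon> *\<^sub>v u)))))"
      by (simp add: integral_sum int)
    also have "\<dots> \<le> (\<Sum>v\<in>M. \<Sum>u\<in>N. exp (l\<^sup>2 / 2))"
      by (intro sum_mono pair)
    also have "\<dots> = real (card M) * real (card N) * exp (l\<^sup>2 / 2)" by simp
    also have "\<dots> \<le> exp b"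
      unfolding exp_b by (intro mult_mono M N) auto
    finally have main: "?E (\<lambda>\<epsilon>. exp (l * (spectral_norm (?X \<epsilon>) / 4))) \<le> exp b" .
    have "l * (?E (\<lambda>\<epsilon>. spectral_norm (?X \<epsilon>)) / 4) = ?E (\<lambda>\<epsilon>. l * (spectral_norm (?X \<epsilon>) / 4))"
      by simp
    \<comment> \<open>The tangent of \<open>exp\<close> at \<open>b\<close> lies below the graph;
      this replaces Jensen's inequality for the logarithm.\<close>
    also have "\<dots> \<le> ?E (\<lambda>\<epsilon>. b - 1 + exp (l * (spectral_norm (?X \<epsilon>) / 4)) / exp b)"
    proof (intro integral_mono int)
      fix \<epsilon>
      have "1 + (l * (spectral_norm (?X \<epsilon>) / 4) - b) \<le> exp (l * (spectral_norm (?X \<epsilon>) / 4) - b)"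
        by (rule exp_ge_add_one_self)
      thus "l * (spectral_norm (?X \<epsilon>) / 4) \<le> b - 1 + exp (l * (spectral_norm (?X \<epsilon>) / 4)) / exp b"
        unfolding exp_diff by linarith
    qed
    also have "\<dots> = b - 1 + ?E (\<lambda>\<epsilon>. exp (l * (spectral_norm (?X \<epsilon>) / 4))) / exp b"
      by (subst Bochner_Integration.integral_add) (auto intro: int)
    also have "\<dots> \<le> b" using main by (simp add: divide_le_eq_1)
    also have "b = l * (l * (ln 48 + 1 / 2))"
      unfolding b_def l(2)[symmetric] by (simp add: power2_eq_square algebra_simps)
    finally have "?E (\<lambda>\<epsilon>. spectral_norm (?X \<epsilon>)) / 4 \<le> l * (ln 48 + 1 / 2)"
      by (simp only: mult_le_cancel_left_pos[OF l(1)])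
    thus ?thesis by (simp add: l_def algebra_simps)
  qed
qed

section \<open>Iterated expectations over finite independent draws\<close>

lemma expectation_pair_pmf_finite:
  fixes f :: "'a \<times> 'b \<Rightarrow> real"
  assumes p: "finite (set_pmf p)" and q: "finite (set_pmf q)"
  shows "measure_pmf.expectation (pair_pmf p q) f
    = measure_pmf.expectation q (\<lambda>b. measure_pmf.expectation p (\<lambda>a. f (a, b)))"
proof -
  have "measure_pmf.expectation (pair_pmf p q) f
      = (\<Sum>(a, b)\<in>set_pmf p \<times> set_pmf q. f (a, b) * (pmf p a * pmf q b))"
    using p q by (subst integral_measure_pmf_real[of "set_pmf p \<times> set_pmf q"])
      (auto simp: pmf_pair intro!: sum.cong)
  also have "\<dots> = (\<Sum>a\<in>set_pmf p. \<Sum>b\<in>set_pmf q. f (a, b) * (pmf p a * pmf q b))"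
    by (rule sum.cartesian_product[symmetric])
  also have "\<dots> = (\<Sum>b\<in>set_pmf q. \<Sum>a\<in>set_pmf p. f (a, b) * (pmf p a * pmf q b))"
    by (rule sum.swap)
  also have "\<dots> = (\<Sum>b\<in>set_pmf q. (\<Sum>a\<in>set_pmf p. f (a, b) * pmf p a) * pmf q b)"
    by (simp add: sum_distrib_right mult.assoc)
  also have "\<dots> = measure_pmf.expectation q (\<lambda>b. measure_pmf.expectation p (\<lambda>a. f (a, b)))"
    by (simp add: integral_measure_pmf_real[OF q] integral_measure_pmf_real[OF p])
  finally show ?thesis .
qed

text \<open>Exposes the sign of a single round as the average over -1 and 1, the form in which it
  appears in the inequality for one round.\<close>

lemma expectation_rademacher_insert:
  fixes g :: "(nat \<Rightarrow> real) \<Rightarrow> real"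
  assumes "finite I" "t \<notin> I"
  shows "measure_pmf.expectation (rademacher (insert t I)) g
    = measure_pmf.expectation (rademacher I) (\<lambda>\<epsilon>. (g (\<epsilon>(t := -1)) + g (\<epsilon>(t := 1))) / 2)"
proof -
  have "rademacher (insert t I)
      = map_pmf (\<lambda>(s, \<epsilon>). \<epsilon>(t := s)) (pair_pmf (pmf_of_set {-1, 1}) (rademacher I))"
    unfolding rademacher_def by (rule Pi_pmf_insert[OF assms])
  thus ?thesis
    using finite_set_rademacher[OF assms(1)]
    by (simp add: expectation_pair_pmf_finite expectation_sign)
qed

section \<open>The regret of the randomized strategy\<close>

text \<open>The game needs from its comparators only that their values in each round are bounded, so
  that the suprema below are genuine. \<open>Y\<close> holds the outcomes for which the loss is
  controlled.\<close>

locale transductive_game =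
  fixes F :: "real mat set" and \<rho> :: real and loss :: "real \<Rightarrow> real \<Rightarrow> real"
    and T :: nat and x :: "nat \<Rightarrow> real mat" and Y :: "real set"
  assumes F_nonempty: "F \<noteq> {}"
    and rho_pos: "0 < \<rho>"
    and bounded: "\<And>t. t < T \<Longrightarrow> \<exists>K. \<forall>f\<in>F. \<bar>mat_inner f (x t)\<bar> \<le> K"
    and lipschitz: "\<And>y. y \<in> Y \<Longrightarrow> \<rho>-lipschitz_on UNIV (\<lambda>p. loss p y)"
begin

text \<open>The coefficients are arbitrary reals rather than signs, so that the prediction (at the
  halves) and the random continuation (at 1 and -1) evaluate the same function.\<close>

definition payoff :: "nat \<Rightarrow> (nat \<Rightarrow> real) \<Rightarrow> (nat \<Rightarrow> real) \<Rightarrow> real mat \<Rightarrow> real" where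
  "payoff t y \<epsilon> f = (\<Sum>i\<in>{t..<T}. \<epsilon> i * mat_inner f (x i))
     - 1 / (2 * \<rho>) * (\<Sum>i<t. loss (mat_inner f (x i)) (y i))"

definition best_payoff :: "nat \<Rightarrow> (nat \<Rightarrow> real) \<Rightarrow> (nat \<Rightarrow> real) \<Rightarrow> real" where
  "best_payoff t y \<epsilon> = (SUP f\<in>F. payoff t y \<epsilon> f)"

lemma loss_diff_le: "y \<in> Y \<Longrightarrow> \<bar>loss p y - loss q y\<bar> \<le> \<rho> * \<bar>p - q\<bar>"
  using lipschitz_onD[OF lipschitz, of y p q] by (simp add: dist_real_def)

lemma best_payoff_cong:
  "(\<And>i. i < t \<Longrightarrow> y i = y' i) \<Longrightarrow> best_payoff t y \<epsilon> = best_payoff t y' \<epsilon>"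
  by (simp add: best_payoff_def payoff_def)

text \<open>The linear part is bounded because the comparator values are; the losses are bounded
  below by comparison with the loss at prediction 0 through the Lipschitz condition.\<close>

lemma bdd_above_payoff:
  assumes "t \<le> T" and y: "\<And>i. i < t \<Longrightarrow> y i \<in> Y"
  shows "bdd_above (payoff t y \<epsilon> ` F)"
proof -
  obtain K where K: "\<And>i f. i < T \<Longrightarrow> f \<in> F \<Longrightarrow> \<bar>mat_inner f (x i)\<bar> \<le> K i"
    using bounded by metis
  define c where "c = (\<Sum>i\<in>{t..<T}. \<bar>\<epsilon> i\<bar> * K i) + 1 / (2 * \<rho>) * (\<Sum>i<t. \<bar>loss 0 (y i)\<bar> + \<rho> * K i)"
  have "payoff t y \<epsilon> f \<le> c" if f: "f \<in> F" for f
  proof -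
    have "\<epsilon> i * mat_inner f (x i) \<le> \<bar>\<epsilon> i\<bar> * K i" if "i \<in> {t..<T}" for i
    proof -
      have "\<epsilon> i * mat_inner f (x i) \<le> \<bar>\<epsilon> i\<bar> * \<bar>mat_inner f (x i)\<bar>"
        by (metis abs_ge_self abs_mult)
      also have "\<dots> \<le> \<bar>\<epsilon> i\<bar> * K i" using that f by (intro mult_left_mono K) auto
      finally show ?thesis .
    qed
    hence 1: "(\<Sum>i\<in>{t..<T}. \<epsilon> i * mat_inner f (x i)) \<le> (\<Sum>i\<in>{t..<T}. \<bar>\<epsilon> i\<bar> * K i)"
      by (rule sum_mono)
    have "- loss (mat_inner f (x i)) (y i) \<le> \<bar>loss 0 (y i)\<bar> + \<rho> * K i" if "i < t" for i
    proof -
      have "\<bar>loss (mat_inner f (x i)) (y i) - loss 0 (y i)\<bar> \<le> \<rho> * \<bar>mat_inner f (x i) - 0\<bar>"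
        using y that by (intro loss_diff_le) auto
      also have "\<dots> \<le> \<rho> * K i"
        using rho_pos that assms(1) f by (intro mult_left_mono) (auto intro: K)
      finally show ?thesis by linarith
    qed
    hence "- (\<Sum>i<t. loss (mat_inner f (x i)) (y i)) \<le> (\<Sum>i<t. \<bar>loss 0 (y i)\<bar> + \<rho> * K i)"
      unfolding sum_negf[symmetric] by (intro sum_mono) simp
    hence "1 / (2 * \<rho>) * - (\<Sum>i<t. loss (mat_inner f (x i)) (y i))
        \<le> 1 / (2 * \<rho>) * (\<Sum>i<t. \<bar>loss 0 (y i)\<bar> + \<rho> * K i)"
      using rho_pos by (intro mult_left_mono) auto
    with 1 show ?thesis unfolding payoff_def c_def by simp
  qed
  thus ?thesis by (rule bdd_aboveI2)
qed

lemma payoff_le_best_payoff: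
  assumes "t \<le> T" "\<And>i. i < t \<Longrightarrow> y i \<in> Y" "f \<in> F"
  shows "payoff t y \<epsilon> f \<le> best_payoff t y \<epsilon>"
  unfolding best_payoff_def using bdd_above_payoff assms by (intro cSUP_upper) auto

lemma best_payoff_leI:
  assumes "\<And>f. f \<in> F \<Longrightarrow> payoff t y \<epsilon> f \<le> c"
  shows "best_payoff t y \<epsilon> \<le> c"
  unfolding best_payoff_def using F_nonempty assms by (intro cSUP_least)

text \<open>Isolates the coefficient of round \<open>t\<close>, in which the payoff is
  affine.\<close>

lemma payoff_split:
  assumes "t < T"
  shows "payoff t y (\<epsilon>(t := c)) f = (\<Sum>i\<in>{t<..<T}. \<epsilon> i * mat_inner f (x i))
     - 1 / (2 * \<rho>) * (\<Sum>i<t. loss (mat_inner f (x i)) (y i)) + c * mat_inner f (x t)"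
proof -
  have "{t..<T} = insert t {t<..<T}" using assms by auto
  thus ?thesis by (simp add: payoff_def)
qed

text \<open>Completing a round trades its linear term for a scaled loss. The coefficient
  \<open>c\<close> is free, so two different choices can be compared for the same
  comparator.\<close>

lemma payoff_Suc:
  assumes "t < T"
  shows "payoff (Suc t) y \<epsilon> f
    = payoff t y (\<epsilon>(t := c)) f - c * mat_inner f (x t) - loss (mat_inner f (x t)) (y t) / (2 * \<rho>)"
  unfolding payoff_split[OF assms]
  by (simp add: payoff_def atLeastSucLessThan_greaterThanLessThan algebra_simps add_divide_distrib)

text \<open>Negation turns infima into suprema and flips the last sign, so the infimum with
  \<open>+ 1 / 2\<close> belongs to coefficient \<open>-1/2\<close>.\<close>

lemma prediction_eq_best_payoff:
  assumes "t < T"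
  shows "prediction F \<rho> loss T x t y \<epsilon> = best_payoff t y (\<epsilon>(t := 1/2)) - best_payoff t y (\<epsilon>(t := -1/2))"
proof -
  have INF_uminus: "(INF f\<in>F. - g f) = - (SUP f\<in>F. g f)" for g :: "real mat \<Rightarrow> real"
    by (simp add: Inf_real_def image_image)
  have eq: "- (\<Sum>i\<in>{t<..<T}. \<epsilon> i * mat_inner f (x i))
        + 1 / (2 * \<rho>) * (\<Sum>i<t. loss (mat_inner f (x i)) (y i)) + 1 / 2 * mat_inner f (x t)
      = - payoff t y (\<epsilon>(t := -1/2)) f"
    "- (\<Sum>i\<in>{t<..<T}. \<epsilon> i * mat_inner f (x i))
        + 1 / (2 * \<rho>) * (\<Sum>i<t. loss (mat_inner f (x i)) (y i)) - 1 / 2 * mat_inner f (x t)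
      = - payoff t y (\<epsilon>(t := 1/2)) f" for f
    unfolding payoff_split[OF assms] by simp_all
  show ?thesis
    unfolding prediction_def eq INF_uminus best_payoff_def by simp
qed

lemma one_step:
  assumes t: "t < T" and y: "\<And>i. i \<le> t \<Longrightarrow> y i \<in> Y"
  shows "loss (prediction F \<rho> loss T x t y \<epsilon>) (y t) + 2 * \<rho> * best_payoff (Suc t) y \<epsilon>
    \<le> \<rho> * (best_payoff t y (\<epsilon>(t := -1)) + best_payoff t y (\<epsilon>(t := 1)))"
proof -
  define W where "W c = best_payoff t y (\<epsilon>(t := c))" for c
  define p where "p = prediction F \<rho> loss T x t y \<epsilon>"
  have p: "p = W (1/2) - W (-1/2)"
    unfolding p_def W_def by (rule prediction_eq_best_payoff[OF t])
  have le_W: "payoff t y (\<epsilon>(t := c)) f \<le> W c" if "f \<in> F" for f c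
    unfolding W_def using t y that by (intro payoff_le_best_payoff) auto
  \<comment> \<open>Convexity in the coefficient, with 1/2 written as 3/4 of 1 plus 1/4 of -1, and
    symmetrically.\<close>
  have half: "W (1/2) \<le> 3/4 * W 1 + 1/4 * W (-1)" "W (-1/2) \<le> 1/4 * W 1 + 3/4 * W (-1)"
    unfolding W_def[of "1/2"] W_def[of "-1/2"]
    using le_W[of _ 1] le_W[of _ "-1"]
    by (intro best_payoff_leI; fastforce simp: payoff_split[OF t])+
  have "best_payoff (Suc t) y \<epsilon> \<le> (\<rho> * (W (-1) + W 1) - loss p (y t)) / (2 * \<rho>)"
  proof (rule best_payoff_leI)
    fix f assume f: "f \<in> F"
    let ?g = "mat_inner f (x t)"
    have 1: "payoff (Suc t) y \<epsilon> f + ?g / 2 + loss ?g (y t) / (2 * \<rho>) \<le> W (1/2)"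
      using le_W[OF f, of "1/2"] payoff_Suc[OF t, of y \<epsilon> f "1/2"] by simp
    have 2: "payoff (Suc t) y \<epsilon> f - ?g / 2 + loss ?g (y t) / (2 * \<rho>) \<le> W (-1/2)"
      using le_W[OF f, of "-1/2"] payoff_Suc[OF t, of y \<epsilon> f "-1/2"] by simp
    have "loss p (y t) - loss ?g (y t) \<le> \<rho> * \<bar>p - ?g\<bar>"
      using loss_diff_le[OF y[OF order_refl], of p ?g] by linarith
    hence "(loss p (y t) - loss ?g (y t)) / \<rho> \<le> \<bar>p - ?g\<bar>"
      using rho_pos by (simp add: field_simps)
    \<comment> \<open>For either sign of \<open>p - ?g\<close>, doubling the suitable one of the two
      bounds and adding \<open>p\<close> or its negative gives the same right-hand side; this is
      what the choice of \<open>p\<close> achieves.\<close>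
    hence "2 * payoff (Suc t) y \<epsilon> f + loss p (y t) / \<rho> \<le> W (1/2) + W (-1/2)"
      using 1 2 unfolding p by (simp add: diff_divide_distrib abs_le_iff)
    also have "\<dots> \<le> W (-1) + W 1" using half by linarith
    finally show "payoff (Suc t) y \<epsilon> f \<le> (\<rho> * (W (-1) + W 1) - loss p (y t)) / (2 * \<rho>)"
      using rho_pos by (simp add: field_simps)
  qed
  thus ?thesis
    using rho_pos unfolding p_def[symmetric] W_def[symmetric] by (simp add: field_simps)
qed

definition potential :: "nat \<Rightarrow> (real \<times> real) list \<Rightarrow> real" where
  "potential t h = (\<Sum>i<t. loss (fst (h ! i)) (snd (h ! i)))
     + 2 * \<rho> * measure_pmf.expectation (rademacher {t..<T}) (best_payoff t (\<lambda>i. snd (h ! i)))"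

text \<open>The outcome \<open>a\<close> is fixed before the draw, and the signs drawn are
  distributed as those averaged in the next potential. Hence \<open>one_step\<close> can be applied
  for each draw and then averaged.\<close>

lemma expectation_potential_Suc_le:
  assumes t: "t < T" and len: "length h = t" and h: "\<And>i. i < t \<Longrightarrow> snd (h ! i) \<in> Y" and a: "a \<in> Y"
  shows "measure_pmf.expectation (rademacher {t<..<T})
      (\<lambda>\<epsilon>. potential (Suc t) (h @ [(prediction F \<rho> loss T x t (\<lambda>i. snd (h ! i)) \<epsilon>, a)]))
    \<le> potential t h"
proof -
  let ?E = "measure_pmf.expectation (rademacher {t<..<T})"
  have int: "integrable (measure_pmf (rademacher {t<..<T})) g" for g :: "_ \<Rightarrow> real"
    by (intro integrable_measure_pmf_finite finite_set_rademacher) simp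
  define L where "L = (\<Sum>i<t. loss (fst (h ! i)) (snd (h ! i)))"
  \<comment> \<open>Appends the current outcome. The prediction and \<open>best_payoff t\<close>
    read only the earlier ones and are unaffected.\<close>
  define y where "y i = (if i = t then a else snd (h ! i))" for i
  define p where "p = prediction F \<rho> loss T x t y"
  have y: "y i \<in> Y" if "i \<le> t" for i using that h a by (auto simp: y_def)
  have pred: "prediction F \<rho> loss T x t (\<lambda>i. snd (h ! i)) = p"
    unfolding p_def y_def prediction_def by (intro ext) simp
  have best: "best_payoff t (\<lambda>i. snd (h ! i)) = best_payoff t y"
    by (intro ext best_payoff_cong) (simp add: y_def)
  have pot: "potential (Suc t) (h @ [(q, a)]) = L + (loss q a + 2 * \<rho> * ?E (best_payoff (Suc t) y))" for q
  proof -
    have "best_payoff (Suc t) (\<lambda>i. snd ((h @ [(q, a)]) ! i)) = best_payoff (Suc t) y"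
      using len by (intro ext best_payoff_cong) (auto simp: y_def nth_append)
    moreover have "(\<Sum>i<t. loss (fst ((h @ [(q, a)]) ! i)) (snd ((h @ [(q, a)]) ! i))) = L"
      unfolding L_def using len by (intro sum.cong refl) (simp add: nth_append)
    ultimately show ?thesis
      using len by (simp add: potential_def atLeastSucLessThan_greaterThanLessThan nth_append)
  qed
  \<comment> \<open>The expectation inside the potential is a constant here; being over the same
    distribution as the draw, it merges with the outer one by linearity.\<close>
  have "?E (\<lambda>\<epsilon>. potential (Suc t) (h @ [(p \<epsilon>, a)]))
      = L + ?E (\<lambda>\<epsilon>. loss (p \<epsilon>) (y t) + 2 * \<rho> * best_payoff (Suc t) y \<epsilon>)"
    unfolding pot by (simp add: int y_def)
  also have "\<dots> \<le> L + ?E (\<lambda>\<epsilon>. \<rho> * (best_payoff t y (\<epsilon>(t := -1)) + best_payoff t y (\<epsilon>(t := 1))))"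
    unfolding p_def by (intro add_left_mono integral_mono int one_step t y)
  also have "\<dots> = L + 2 * \<rho> * ?E (\<lambda>\<epsilon>. (best_payoff t y (\<epsilon>(t := -1)) + best_payoff t y (\<epsilon>(t := 1))) / 2)"
    by simp
  also have "\<dots> = L + 2 * \<rho> * measure_pmf.expectation (rademacher (insert t {t<..<T})) (best_payoff t y)"
    by (subst expectation_rademacher_insert) auto
  also have "insert t {t<..<T} = {t..<T}" using t by auto
  finally show ?thesis by (simp add: pred potential_def L_def best)
qed

text \<open>A prefix of \<open>draws T\<close>. The horizon \<open>T\<close> stays fixed, whereas
  \<open>draws t\<close> would also shorten the range of the signs in each round.\<close>

definition rounds :: "nat \<Rightarrow> (nat \<Rightarrow> nat \<Rightarrow> real) pmf" where
  "rounds t = Pi_pmf {..<t} (\<lambda>_. 0) (\<lambda>s. rademacher {s<..<T})"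

lemma finite_set_rounds: "finite (set_pmf (rounds t))"
  unfolding rounds_def
  by (intro finite_subset[OF set_Pi_pmf_subset'] finite_PiE_dflt) (auto intro: finite_set_rademacher)

lemma expectation_rounds_Suc:
  fixes g :: "(nat \<Rightarrow> nat \<Rightarrow> real) \<Rightarrow> real"
  shows "measure_pmf.expectation (rounds (Suc t)) g = measure_pmf.expectation (rounds t)
    (\<lambda>E. measure_pmf.expectation (rademacher {t<..<T}) (\<lambda>\<epsilon>. g (E(t := \<epsilon>))))"
proof -
  have "rounds (Suc t) = map_pmf (\<lambda>(\<epsilon>, E). E(t := \<epsilon>)) (pair_pmf (rademacher {t<..<T}) (rounds t))"
    unfolding rounds_def lessThan_Suc by (rule Pi_pmf_insert) auto
  thus ?thesis
    using finite_set_rounds finite_set_rademacher[of "{t<..<T}"]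
    by (simp add: expectation_pair_pmf_finite)
qed

context
  fixes adv :: "(real \<times> real) list \<Rightarrow> real"
  assumes adv: "\<And>h. adv h \<in> Y"
begin

lemma length_play: "length (play F \<rho> loss T x adv E t) = t"
  by (induction t) (auto simp: Let_def)

lemma snd_play: "i < t \<Longrightarrow> snd (play F \<rho> loss T x adv E t ! i) \<in> Y"
  using adv by (induction t) (auto simp: Let_def nth_append length_play less_Suc_eq)

lemma play_cong: "(\<And>s. s < t \<Longrightarrow> E s = E' s) \<Longrightarrow> play F \<rho> loss T x adv E t = play F \<rho> loss T x adv E' t"
  by (induction t) (auto simp: Let_def)

lemma expectation_potential_play_le:
  "t \<le> T \<Longrightarrow> measure_pmf.expectation (rounds t) (\<lambda>E. potential t (play F \<rho> loss T x adv E t)) \<le> potential 0 []"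
proof (induction t)
  case 0
  show ?case by simp
next
  case (Suc t)
  have "measure_pmf.expectation (rounds (Suc t)) (\<lambda>E. potential (Suc t) (play F \<rho> loss T x adv E (Suc t)))
      \<le> measure_pmf.expectation (rounds t) (\<lambda>E. potential t (play F \<rho> loss T x adv E t))"
    unfolding expectation_rounds_Suc
  proof (intro integral_mono integrable_measure_pmf_finite finite_set_rounds)
    fix E
    let ?h = "play F \<rho> loss T x adv E t"
    \<comment> \<open>The draw of round \<open>t\<close> leaves the earlier history alone, so the
      adversary's outcome is constant under the inner expectation.\<close>
    have "play F \<rho> loss T x adv (E(t := \<epsilon>)) t = ?h" for \<epsilon>
      by (rule play_cong) simp
    hence "play F \<rho> loss T x adv (E(t := \<epsilon>)) (Suc t)
        = ?h @ [(prediction F \<rho> loss T x t (\<lambda>i. snd (?h ! i)) \<epsilon>, adv ?h)]" for \<epsilon>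
      by (simp add: Let_def)
    thus "measure_pmf.expectation (rademacher {t<..<T})
        (\<lambda>\<epsilon>. potential (Suc t) (play F \<rho> loss T x adv (E(t := \<epsilon>)) (Suc t))) \<le> potential t ?h"
      using expectation_potential_Suc_le[of t ?h "adv ?h"] Suc.prems length_play snd_play adv by simp
  qed
  with Suc show ?case by simp
qed

lemma regret_le_potential:
  assumes h: "\<And>i. i < T \<Longrightarrow> snd (h ! i) \<in> Y"
  shows "regret F loss T x h \<le> potential T h"
proof -
  let ?y = "\<lambda>i. snd (h ! i)"
  have "- (2 * \<rho> * best_payoff T ?y \<epsilon>) \<le> (INF f\<in>F. \<Sum>t<T. loss (mat_inner f (x t)) (?y t))" for \<epsilon>
  proof (rule cINF_greatest[OF F_nonempty])
    fix f assume "f \<in> F"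
    from payoff_le_best_payoff[OF order_refl h this, where \<epsilon> = \<epsilon>]
    have "- (2 * \<rho> * best_payoff T ?y \<epsilon>) \<le> - (2 * \<rho> * payoff T ?y \<epsilon> f)"
      using rho_pos by simp
    also have "\<dots> = (\<Sum>t<T. loss (mat_inner f (x t)) (?y t))"
      using rho_pos by (simp add: payoff_def)
    finally show "- (2 * \<rho> * best_payoff T ?y \<epsilon>) \<le> (\<Sum>t<T. loss (mat_inner f (x t)) (?y t))" .
  qed
  \<comment> \<open>With no round left the distribution is concentrated on the default function 0,
    and the best payoff is a scaled negative of the smallest comparator loss.\<close>
  moreover have "measure_pmf.expectation (rademacher {T..<T}) (best_payoff T ?y) = best_payoff T ?y (\<lambda>_. 0)"
    by (simp add: rademacher_def)
  ultimately show ?thesis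
    unfolding regret_def potential_def by (smt (verit))
qed

lemma expected_regret_le:
  "expected_regret F \<rho> loss T x adv
    \<le> 2 * \<rho> * measure_pmf.expectation (rademacher {..<T}) (\<lambda>\<epsilon>. SUP f\<in>F. \<Sum>t<T. \<epsilon> t * mat_inner f (x t))"
proof -
  have "expected_regret F \<rho> loss T x adv
      \<le> measure_pmf.expectation (rounds T) (\<lambda>E. potential T (play F \<rho> loss T x adv E T))"
    unfolding expected_regret_def draws_def rounds_def[symmetric]
    by (intro integral_mono integrable_measure_pmf_finite finite_set_rounds regret_le_potential snd_play)
  also have "\<dots> \<le> potential 0 []" by (rule expectation_potential_play_le) simp
  finally show ?thesis
    by (simp add: potential_def best_payoff_def[abs_def] payoff_def atLeast0LessThan)
qed

end

end

section \<open>The trace-norm ball as comparator set\<close>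

lemma trace_norm_zero: "trace_norm (0\<^sub>m m n) = 0"
proof -
  have "trace_norm (0\<^sub>m m n) = (\<Sum>i<n. sqrt ((transpose_mat (1\<^sub>m n) * (transpose_mat (0\<^sub>m m n) * 0\<^sub>m m n) * 1\<^sub>m n) $$ (i, i)))"
    by (rule trace_norm_eq_sum) (auto simp: diagonal_mat_def)
  also have "\<dots> = 0" by (intro sum.neutral) auto
  finally show ?thesis .
qed

lemma trace_ball_mat_inner_le:
  assumes "f \<in> trace_ball m n B" "M \<in> carrier_mat m n"
  shows "mat_inner f M \<le> B * spectral_norm M"
proof -
  have "mat_inner f M \<le> trace_norm f * spectral_norm M"
    using assms by (intro mat_inner_le_trace_norm_spectral_norm) (auto simp: trace_ball_def)
  also have "\<dots> \<le> B * spectral_norm M"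
    using assms by (intro mult_right_mono spectral_norm_nonneg) (auto simp: trace_ball_def)
  finally show ?thesis .
qed

lemma mat_inner_signed_sum:
  assumes f: "f \<in> carrier_mat m n" and x: "\<And>t. t < T \<Longrightarrow> x t \<in> carrier_mat m n"
  shows "mat_inner f (signed_sum m n T x \<epsilon>) = (\<Sum>t<T. \<epsilon> t * mat_inner f (x t))"
proof -
  have "mat_inner f (signed_sum m n T x \<epsilon>) = (\<Sum>j<n. \<Sum>i<m. \<Sum>t<T. \<epsilon> t * (f $$ (i, j) * x t $$ (i, j)))"
    unfolding mat_inner_sum_entries[OF f signed_sum_carrier]
    by (intro sum.cong refl) (simp add: signed_sum_def sum_distrib_left mult.left_commute)
  also have "\<dots> = (\<Sum>j<n. \<Sum>t<T. \<Sum>i<m. \<epsilon> t * (f $$ (i, j) * x t $$ (i, j)))"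
    by (rule sum.cong[OF refl], rule sum.swap)
  also have "\<dots> = (\<Sum>t<T. \<Sum>j<n. \<Sum>i<m. \<epsilon> t * (f $$ (i, j) * x t $$ (i, j)))"
    by (rule sum.swap)
  also have "\<dots> = (\<Sum>t<T. \<epsilon> t * mat_inner f (x t))"
    using mat_inner_sum_entries[OF f x] by (intro sum.cong refl) (simp add: sum_distrib_left)
  finally show ?thesis .
qed

lemma expected_regret_trace_ball_le:
  assumes B: "0 \<le> B" and rho: "0 < \<rho>" and x: "\<And>t. x t \<in> carrier_mat m n"
    and lip: "\<And>y. y \<in> Y \<Longrightarrow> \<rho>-lipschitz_on UNIV (\<lambda>p. loss p y)" and adv: "\<And>h. adv h \<in> Y"
  shows "expected_regret (trace_ball m n B) \<rho> loss T x adv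
    \<le> 2 * B * \<rho> * measure_pmf.expectation (rademacher {..<T}) (\<lambda>\<epsilon>. spectral_norm (signed_sum m n T x \<epsilon>))"
proof -
  let ?F = "trace_ball m n B"
  have F: "?F \<noteq> {}"
    using B trace_norm_zero[of m n] by (auto simp: trace_ball_def intro!: exI[of _ "0\<^sub>m m n"])
  \<comment> \<open>The duality bound is one-sided; applying it also to \<open>- x t\<close> gives
    an absolute bound, without comparing the two spectral norms.\<close>
  have abs_le: "\<bar>mat_inner f (x t)\<bar> \<le> max (B * spectral_norm (x t)) (B * spectral_norm (- x t))"
    if f: "f \<in> ?F" for f t
  proof -
    have fc: "f \<in> carrier_mat m n" using f by (simp add: trace_ball_def)
    have "mat_inner f (- x t) = - mat_inner f (x t)"
      using x[of t] unfolding mat_inner_sum_entries[OF fc x] mat_inner_sum_entries[OF fc uminus_carrier_mat[OF x]]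
      by (simp flip: sum_negf)
    thus ?thesis
      using trace_ball_mat_inner_le[OF f x, of t] trace_ball_mat_inner_le[OF f uminus_carrier_mat[OF x], of t]
      by (auto simp: abs_le_iff max_def)
  qed
  interpret transductive_game ?F \<rho> loss T x Y
    by unfold_locales (use F rho lip abs_le in blast)+
  have "expected_regret ?F \<rho> loss T x adv
    \<le> 2 * \<rho> * measure_pmf.expectation (rademacher {..<T}) (\<lambda>\<epsilon>. SUP f\<in>?F. \<Sum>t<T. \<epsilon> t * mat_inner f (x t))"
    by (rule expected_regret_le[OF adv])
  also have "\<dots> \<le> 2 * \<rho> * measure_pmf.expectation (rademacher {..<T}) (\<lambda>\<epsilon>. B * spectral_norm (signed_sum m n T x \<epsilon>))"
  proof (intro mult_left_mono integral_mono integrable_measure_pmf_finite finite_set_rademacher cSUP_least F)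
    fix \<epsilon> f assume f: "f \<in> ?F"
    hence "(\<Sum>t<T. \<epsilon> t * mat_inner f (x t)) = mat_inner f (signed_sum m n T x \<epsilon>)"
      using x by (subst mat_inner_signed_sum) (auto simp: trace_ball_def)
    also have "\<dots> \<le> B * spectral_norm (signed_sum m n T x \<epsilon>)"
      by (rule trace_ball_mat_inner_le[OF f]) simp
    finally show "(\<Sum>t<T. \<epsilon> t * mat_inner f (x t)) \<le> B * spectral_norm (signed_sum m n T x \<epsilon>)" .
  qed (use rho in auto)
  finally show ?thesis by (simp add: mult_ac)
qed

theorem corollary21:
  shows "\<exists>C>0. \<forall>(m::nat) (n::nat) (T::nat) (loc :: nat \<Rightarrow> nat \<times> nat) (B::real) (\<rho>::real)
      (Y :: real set) (loss :: real \<Rightarrow> real \<Rightarrow> real) (adv :: (real \<times> real) list \<Rightarrow> real).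
    (\<forall>t<T. loc t \<in> {..<m} \<times> {..<n}) \<longrightarrow> 0 \<le> B \<longrightarrow> 0 < \<rho> \<longrightarrow>
    (\<forall>y\<in>Y. convex_on UNIV (\<lambda>p. loss p y) \<and> \<rho>-lipschitz_on UNIV (\<lambda>p. loss p y)) \<longrightarrow>
    (\<forall>h. adv h \<in> Y) \<longrightarrow>
    (let x = (\<lambda>t. entry_mat m n (loc t));
         S = measure_pmf.expectation (rademacher {..<T})
               (\<lambda>\<epsilon>. spectral_norm (signed_sum m n T x \<epsilon>))
     in expected_regret (trace_ball m n B) \<rho> loss T x adv \<le> 2 * B * \<rho> * S \<and>
        (inj_on loc {..<T} \<longrightarrow> 2 * B * \<rho> * S \<le> C * (B * \<rho> * (sqrt (real m) + sqrt (real n)))))"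
\<comment> \<open>The factor 8 is the 4 from the two nets times the 2 in the regret bound.\<close>
proof (rule exI[of _ "8 * (ln 48 + 1 / 2)"], intro conjI allI impI)
  have ln48: "ln 48 \<ge> (0::real)" by simp
  thus "0 < 8 * (ln 48 + 1 / 2 :: real)" by (intro mult_pos_pos add_nonneg_pos) auto
  fix m n T :: nat and loc :: "nat \<Rightarrow> nat \<times> nat" and B \<rho> :: real and Y :: "real set"
    and loss :: "real \<Rightarrow> real \<Rightarrow> real" and adv :: "(real \<times> real) list \<Rightarrow> real"
  assume loc: "\<forall>t<T. loc t \<in> {..<m} \<times> {..<n}" and B: "0 \<le> B" and rho: "0 < \<rho>"
    and loss: "\<forall>y\<in>Y. convex_on UNIV (\<lambda>p. loss p y) \<and> \<rho>-lipschitz_on UNIV (\<lambda>p. loss p y)"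
    and adv: "\<forall>h. adv h \<in> Y"
  define S where "S = measure_pmf.expectation (rademacher {..<T})
    (\<lambda>\<epsilon>. spectral_norm (signed_sum m n T (\<lambda>t. entry_mat m n (loc t)) \<epsilon>))"
  have "expected_regret (trace_ball m n B) \<rho> loss T (\<lambda>t. entry_mat m n (loc t)) adv \<le> 2 * B * \<rho> * S"
    unfolding S_def using loss adv by (intro expected_regret_trace_ball_le[where Y = Y] B rho) auto
  moreover have "2 * B * \<rho> * S \<le> 8 * (ln 48 + 1 / 2) * (B * \<rho> * (sqrt (real m) + sqrt (real n)))"
    if "inj_on loc {..<T}"
  proof -
    have "S \<le> 4 * (ln 48 + 1 / 2) * sqrt (real (m + n))"
      unfolding S_def using loc that by (intro expectation_spectral_norm_le) auto
    also have "\<dots> \<le> 4 * (ln 48 + 1 / 2) * (sqrt (real m) + sqrt (real n))"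
      using ln48 by (intro mult_left_mono) (auto simp: sqrt_add_le_add_sqrt)
    finally have "2 * B * \<rho> * S \<le> 2 * B * \<rho> * (4 * (ln 48 + 1 / 2) * (sqrt (real m) + sqrt (real n)))"
      using B rho by (intro mult_left_mono) auto
    thus ?thesis by (simp add: mult_ac)
  qed
  ultimately show "let x = (\<lambda>t. entry_mat m n (loc t));
         S = measure_pmf.expectation (rademacher {..<T})
               (\<lambda>\<epsilon>. spectral_norm (signed_sum m n T x \<epsilon>))
     in expected_regret (trace_ball m n B) \<rho> loss T x adv \<le> 2 * B * \<rho> * S \<and>
        (inj_on loc {..<T} \<longrightarrow> 2 * B * \<rho> * S \<le> 8 * (ln 48 + 1 / 2) * (B * \<rho> * (sqrt (real m) + sqrt (real n))))"
    unfolding Let_def S_def by blast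
qed

end
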